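(* For all integers $d \geq 2$ and $k \geq d+1$, there are constants $C=C(d,k)>0$ and $n_0=n_0(d,k)$ such that, for every integer $n \ge n_0$ and every convex body $K \subseteq \mathbb{R}^d$ of unit volume, we have $EH^K_{d,k}(n) \geq C \cdot n^d$.
   Context: A convex body in $\mathbb{R}^d$ is a compact convex subset of $\mathbb{R}^d$ with nonempty interior; volume means $d$-dimensional Lebesgue measure. A finite point set is in convex position if none of its points lies in the convex hull of the remaining points. A finite set $S\subseteq\mathbb{R}^d$ is in general position if for every $j\in\{1,\dots,d-1\}$ no $j+2$ points of $S$ lie on a $j$-dimensional affine subspace of $\mathbb{R}^d$. For an integer $k\ge d+1$, a $k$-hole in a finite set $S\subseteq\mathbb{R}^d$ in general position is a set of $k$ points of $S$ in convex position whose convex hull contains no point of $S$ in its interior. For a convex body $K\subseteq\mathbb{R}^d$ of unit volume, $EH^K_{d,k}(n)$ denotes the expected number of $k$-holes in a set of $n$ points chosen uniformly and independently at random from $K$ (such a set is in general position with probability $1$). *)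

theory Defs
  imports "HOL-Probability.Probability"
begin

definition convex_body :: "'a::euclidean_space set \<Rightarrow> bool"
  where "convex_body K \<longleftrightarrow> compact K \<and> convex K \<and> interior K \<noteq> {}"

definition convex_position :: "'a::euclidean_space set \<Rightarrow> bool"
  where "convex_position T \<longleftrightarrow> finite T \<and> (\<forall>x\<in>T. x \<notin> convex hull (T - {x}))"

definition general_position :: "'a::euclidean_space set \<Rightarrow> bool"
  where "general_position S \<longleftrightarrow> finite S \<and>
    (\<forall>j\<in>{1..DIM('a) - 1}. \<not> (\<exists>T A. T \<subseteq> S \<and> card T = j + 2 \<and>
       affine A \<and> aff_dim A = int j \<and> T \<subseteq> A))"

text \<open>
  Holes are only considered in sets in general position; the number of holes in any other
  set is therefore 0 by convention. This concerns a null set of random samples only.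
\<close>

definition is_hole :: "nat \<Rightarrow> 'a::euclidean_space set \<Rightarrow> 'a set \<Rightarrow> bool"
  where "is_hole k S T \<longleftrightarrow> general_position S \<and> T \<subseteq> S \<and> card T = k \<and>
    convex_position T \<and> interior (convex hull T) \<inter> S = {}"

definition num_holes :: "nat \<Rightarrow> 'a::euclidean_space set \<Rightarrow> nat"
  where "num_holes k S = card {T. is_hole k S T}"

text \<open>
  A sample of \<open>n\<close> independent uniform points of \<open>K\<close> is a function on \<open>{..<n}\<close>, distributed
  according to the product of \<open>n\<close> copies of the uniform measure on \<open>K\<close>. The number of holes
  is a nonnegative random variable, so its expectation is taken as a nonnegative integral.
\<close>

definition expected_holes :: "'a::euclidean_space set \<Rightarrow> nat \<Rightarrow> nat \<Rightarrow> ennreal"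
  where "expected_holes K k n =
    (\<integral>\<^sup>+ X. of_nat (num_holes k (X ` {..<n})) \<partial>(\<Pi>\<^sub>M i\<in>{..<n}. uniform_measure lborel K))"

end

theory Submission imports Defs
begin

text \<open>
  Normalize \<open>K\<close> by a simplex of maximal volume inscribed in it, so that \<open>K\<close> contains an affine image of a
  fixed large cube with volume bounded below. In the cube, take the \<open>n ^ d\<close> hyperplanes whose \<open>d\<close>
  coefficients are multiples of \<open>1 / n\<close> in \<open>[0, 1)\<close>. Over each of them place \<open>k\<close> cells of volume of order
  \<open>1 / n\<close> along a paraboloid flattened to height of order \<open>1 / n\<close>, all inside a slab of volume at most
  \<open>1 / (2 * n)\<close>. One point from each cell always gives a set in convex position, hence a hole as soon as the
  remaining points avoid the slab. This happens with probability at least \<open>1 / 2\<close>, and the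
  \<open>k\<close> cells are hit by \<open>k\<close> prescribed sample points with probability of order \<open>n\<close> to the power \<open>-k\<close>.
  There are of order \<open>n ^ k\<close> choices of the sample points, and different choices of hyperplane and
  sample points give different holes. Since the cells are fixed sets, all these probabilities are plain products.
\<close>

section \<open>Volume scaling of affine bijections\<close>

text \<open>Uniqueness of Haar measure up to a factor, by Fubini: the double integral of
  \<open>indicator A x * indicator B (x + y)\<close> factors as one side when \<open>y\<close> is
  integrated first, and as the other after substituting \<open>u = x + y\<close>.\<close>

lemma translation_invariant_proportional_lborel:
  fixes N :: "'a::euclidean_space measure"
  assumes sets: "sets N = sets borel" and sf: "sigma_finite_measure N"
    and inv: "\<And>c A. A \<in> sets borel \<Longrightarrow> emeasure N ((\<lambda>x. x + c) -` A) = emeasure N A"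
    and A: "A \<in> sets borel" and B: "B \<in> sets borel"
  shows "emeasure N A * emeasure lborel B = emeasure N B * emeasure lborel A"
proof -
  have A'[measurable]: "A \<in> sets N" "A \<in> sets borel" and B'[measurable]: "B \<in> sets N" "B \<in> sets borel"
    using A B sets by auto
  have [measurable_cong]: "sets N = sets borel" by fact
  have spN: "space N = UNIV" using sets_eq_imp_space_eq[OF sets] by simp
  interpret N: sigma_finite_measure N by fact
  interpret L: sigma_finite_measure "lborel :: 'a measure" by (rule sigma_finite_lborel)
  interpret P: pair_sigma_finite "lborel :: 'a measure" N ..
  have shift: "emeasure lborel ((\<lambda>y. x + y) -` B) = emeasure lborel B" for x
  proof -
    have "emeasure lborel B = emeasure (distr lborel borel ((+) x)) B"
      by (simp add: lborel_distr_plus)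
    also have "\<dots> = emeasure lborel ((\<lambda>y. x + y) -` B)"
      using B by (subst emeasure_distr) (auto simp: space_lborel)
    finally show ?thesis by simp
  qed
  have reflect: "emeasure lborel ((\<lambda>y. u - y) -` A) = emeasure lborel A" for u
  proof -
    have "lborel = distr lborel borel (\<lambda>x::'a. u - x)"
      using lborel_affine[of "-1" u] by (simp add: density_1)
    then have "emeasure lborel A = emeasure (distr lborel borel (\<lambda>x::'a. u - x)) A" by simp
    also have "\<dots> = emeasure lborel ((\<lambda>y. u - y) -` A)"
      using A by (subst emeasure_distr) (auto simp: space_lborel)
    finally show ?thesis by simp
  qed
  have "(\<integral>\<^sup>+x. \<integral>\<^sup>+y. indicator A x * indicator B (x + y) \<partial>lborel \<partial>N)
      = (\<integral>\<^sup>+x. indicator A x * emeasure lborel B \<partial>N)"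
  proof (rule nn_integral_cong)
    fix x
    have "(\<integral>\<^sup>+y. indicator A x * indicator B (x + y) \<partial>lborel)
        = indicator A x * (\<integral>\<^sup>+y. indicator ((\<lambda>y. x + y) -` B) y \<partial>lborel)"
      by (subst nn_integral_cmult[symmetric]) (auto simp: indicator_def vimage_def)
    also have "(\<integral>\<^sup>+y. indicator ((\<lambda>y. x + y) -` B) y \<partial>lborel) = emeasure lborel B"
      using measurable_sets[of "\<lambda>y. x + y" borel borel B] B
      by (subst nn_integral_indicator) (auto simp: shift)
    finally show "(\<integral>\<^sup>+y. indicator A x * indicator B (x + y) \<partial>lborel) = indicator A x * emeasure lborel B" .
  qed
  also have "\<dots> = emeasure N A * emeasure lborel B"
    by (simp add: nn_integral_multc)
  finally have 1: "(\<integral>\<^sup>+x. \<integral>\<^sup>+y. indicator A x * indicator B (x + y) \<partial>lborel \<partial>N)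
      = emeasure N A * emeasure lborel B" .
  have "(\<integral>\<^sup>+x. \<integral>\<^sup>+y. indicator A x * indicator B (x + y) \<partial>lborel \<partial>N)
      = (\<integral>\<^sup>+y. \<integral>\<^sup>+x. indicator A x * indicator B (x + y) \<partial>N \<partial>lborel)"
    by (rule P.Fubini') measurable
  \<comment> \<open>The substitution \<open>u = x + y\<close> in the inner integral is the
    invariance of \<open>N\<close>, applied to the set \<open>E\<close> that collects both
    indicators.\<close>
  also have "\<dots> = (\<integral>\<^sup>+y. \<integral>\<^sup>+u. indicator A (u - y) * indicator B u \<partial>N \<partial>lborel)"
  proof (rule nn_integral_cong)
    fix y
    define E where "E = {u. u - y \<in> A \<and> u \<in> B}"
    have [measurable]: "E \<in> sets borel" unfolding E_def by measurable
    have "(\<integral>\<^sup>+x. indicator A x * indicator B (x + y) \<partial>N) = (\<integral>\<^sup>+x. indicator ((\<lambda>x. x + y) -` E) x \<partial>N)"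
      by (rule nn_integral_cong) (auto simp: indicator_def E_def)
    also have "\<dots> = emeasure N ((\<lambda>x. x + y) -` E)"
    proof -
      have "(\<lambda>x. x + y) -` E \<inter> space N \<in> sets N" by measurable
      then show ?thesis by (simp add: spN)
    qed
    also have "\<dots> = emeasure N E" by (rule inv) simp
    also have "\<dots> = (\<integral>\<^sup>+u. indicator E u \<partial>N)" by simp
    also have "\<dots> = (\<integral>\<^sup>+u. indicator A (u - y) * indicator B u \<partial>N)"
      by (rule nn_integral_cong) (auto simp: indicator_def E_def)
    finally show "(\<integral>\<^sup>+x. indicator A x * indicator B (x + y) \<partial>N) = \<dots>" .
  qed
  also have "\<dots> = (\<integral>\<^sup>+u. \<integral>\<^sup>+y. indicator A (u - y) * indicator B u \<partial>lborel \<partial>N)"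
    by (rule P.Fubini'[symmetric]) measurable
  also have "\<dots> = (\<integral>\<^sup>+u. indicator B u * emeasure lborel A \<partial>N)"
  proof (rule nn_integral_cong)
    fix u
    have "(\<integral>\<^sup>+y. indicator A (u - y) * indicator B u \<partial>lborel)
        = indicator B u * (\<integral>\<^sup>+y. indicator ((\<lambda>y. u - y) -` A) y \<partial>lborel)"
      by (subst nn_integral_cmult[symmetric]) (auto simp: indicator_def vimage_def)
    also have "(\<integral>\<^sup>+y. indicator ((\<lambda>y. u - y) -` A) y \<partial>lborel) = emeasure lborel A"
      using measurable_sets[of "\<lambda>y. u - y" borel borel A] A
      by (subst nn_integral_indicator) (auto simp: reflect)
    finally show "(\<integral>\<^sup>+y. indicator A (u - y) * indicator B u \<partial>lborel) = indicator B u * emeasure lborel A" .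
  qed
  also have "\<dots> = emeasure N B * emeasure lborel A"
    by (simp add: nn_integral_multc)
  finally show ?thesis using 1 by simp
qed

text \<open>Plays the part of the absolute determinant. Borel images are included so that the
  factors multiply under composition.\<close>

definition volume_scaling :: "('a::euclidean_space \<Rightarrow> 'a) \<Rightarrow> real \<Rightarrow> bool"
  where "volume_scaling f D \<longleftrightarrow> D > 0 \<and> (\<forall>S\<in>sets borel. f ` S \<in> sets borel \<and>
    emeasure lborel (f ` S) = ennreal D * emeasure lborel S)"

text \<open>The measure giving each set the volume of its image is translation invariant and finite
  on compact sets, hence proportional to \<open>lborel\<close>. The factor is its value on the unit
  cube, positive because the image of the open cube is open.\<close>

lemma affine_bij_volume_scaling:
  fixes F :: "'a::euclidean_space \<Rightarrow> 'a"
  assumes F: "linear F" "bij F"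
  obtains D where "volume_scaling (\<lambda>x. v + F x) D"
proof -
  let ?f = "\<lambda>x. v + F x"
  let ?g = "\<lambda>y. inv F (y - v)"
  have linG: "linear (inv F)" using F by (simp add: bij_is_inj inj_linear_imp_inv_linear)
  have img: "?f ` S = ?g -` S" for S
    using F(2) by (auto simp: image_iff bij_is_inj bij_is_surj surj_f_inv_f inv_f_f intro!: bexI[of _ "inv F (_ - v)"])
  have gm[measurable]: "?g \<in> borel_measurable borel"
    by (intro borel_measurable_continuous_onI continuous_on_compose2[OF linear_continuous_on[of "inv F" UNIV]]
        continuous_intros) (auto simp: linG linear_conv_bounded_linear[symmetric])
  define N where "N = distr lborel borel ?g"
  have NE: "emeasure N S = emeasure lborel (?f ` S)" if "S \<in> sets borel" for S
    using that unfolding N_def img by (subst emeasure_distr) (auto simp: space_lborel)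
  have setsb: "?f ` S \<in> sets borel" if "S \<in> sets borel" for S
    using measurable_sets[OF gm that] by (simp add: img)
  have cont: "continuous_on S ?f" for S
    using F(1) by (intro continuous_intros linear_continuous_on) (simp add: linear_conv_bounded_linear)
  have fin: "emeasure N S < \<infinity>" if "compact S" for S
    using emeasure_compact_finite[OF compact_continuous_image[OF cont that]] NE[of S]
      borel_compact[OF that] by simp
  have sf: "sigma_finite_measure N"
  proof
    show "\<exists>A. countable A \<and> A \<subseteq> sets N \<and> \<Union>A = space N \<and> (\<forall>a\<in>A. emeasure N a \<noteq> \<infinity>)"
    proof (intro exI[of _ "range (\<lambda>n::nat. cball 0 (real n))"] conjI ballI)
      show "\<Union>(range (\<lambda>n::nat. cball 0 (real n))) = space N"
        by (auto simp: N_def real_arch_simple)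
      fix a :: "'a set" assume "a \<in> range (\<lambda>n::nat. cball 0 (real n))"
      then show "emeasure N a \<noteq> \<infinity>" using fin[of a] by (auto simp: less_top)
    qed (auto simp: N_def)
  qed
  have inv: "emeasure N ((\<lambda>x. x + c) -` A) = emeasure N A" if A: "A \<in> sets borel" for c A
  proof -
    have m: "(\<lambda>x. x + c) -` A \<in> sets borel"
      using measurable_sets[of "\<lambda>x. x + c" borel borel A] A by simp
    \<comment> \<open>Translating the argument by \<open>c\<close> translates the image by
      \<open>F c\<close>.\<close>
    have e: "?f ` ((\<lambda>x. x + c) -` A) = (\<lambda>y. F c + y) -` (?f ` A)"
      unfolding img using linear_add[OF linG] F(2)
      by (auto simp: linear_diff[OF linG] bij_is_inj inv_f_f linear_add[OF linG] algebra_simps)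
    have "emeasure lborel ((\<lambda>y. F c + y) -` (?f ` A)) = emeasure (distr lborel borel ((+) (F c))) (?f ` A)"
      using setsb[OF A] by (subst emeasure_distr) (auto simp: space_lborel)
    then show ?thesis using NE[OF A] NE[OF m] e by (simp add: lborel_distr_plus)
  qed
  define U where "U = cbox (0::'a) One"
  have U1: "emeasure lborel U = 1" unfolding U_def
    by (simp add: emeasure_lborel_cbox_eq inner_Basis)
  have U: "U \<in> sets borel" "compact U" by (auto simp: U_def compact_cbox)
  have "emeasure N U > 0"
  proof -
    have "box (0::'a) One \<noteq> {}" by (simp add: box_ne_empty)
    then have "interior U \<noteq> {}" by (simp add: U_def interior_cbox)
    moreover have "?f ` interior U = (+) v ` (F ` interior U)" by auto
    moreover have "open (F ` interior U)"
      using F open_surjective_linear_image bij_is_surj by blast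
    ultimately have "open (?f ` interior U)" "?f ` interior U \<noteq> {}"
      by (auto simp: open_translation)
    then have "\<not> negligible (?f ` interior U)" "?f ` interior U \<in> sets borel"
      using open_not_negligible by auto
    then have "emeasure lborel (?f ` interior U) > 0"
      by (auto simp: negligible_iff_emeasure0 zero_less_iff_neq_zero)
    then show ?thesis
      using emeasure_mono[of "?f ` interior U" "?f ` U" lborel] setsb[OF U(1)] NE[OF U(1)]
      by (metis (no_types, lifting) image_mono interior_subset less_le_trans sets_lborel)
  qed
  define D where "D = enn2real (emeasure N U)"
  have D: "ennreal D = emeasure N U" "D > 0"
    using fin[OF U(2)] \<open>emeasure N U > 0\<close> by (auto simp: D_def enn2real_positive_iff)
  have "emeasure lborel (?f ` S) = ennreal D * emeasure lborel S" if S: "S \<in> sets borel" for S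
    using translation_invariant_proportional_lborel[OF _ sf inv S U(1)] NE[OF S]
    by (simp add: N_def[symmetric] U1 D) (simp add: N_def)
  then show ?thesis using that D(2) setsb unfolding volume_scaling_def by blast
qed

lemma volume_scaling_comp:
  assumes "volume_scaling f D" "volume_scaling g E"
  shows "volume_scaling (f \<circ> g) (D * E)"
  using assms unfolding volume_scaling_def
  by (simp only: image_comp[symmetric]) (simp add: ennreal_mult' mult.assoc)

lemma volume_scaling_unique:
  fixes f :: "'a::euclidean_space \<Rightarrow> 'a"
  assumes "volume_scaling f D" "volume_scaling f E"
  shows "D = E"
proof -
  have "emeasure lborel (cbox (0::'a) One) = 1"
    by (simp add: emeasure_lborel_cbox_eq inner_Basis)
  moreover have "cbox (0::'a) One \<in> sets borel" by simp
  ultimately have "ennreal D = ennreal E" "D > 0" "E > 0"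
    using assms unfolding volume_scaling_def by (metis mult.right_neutral)+
  then show ?thesis by (simp add: ennreal_inj)
qed

lemma volume_scaling_id: "volume_scaling id 1"
  by (simp add: volume_scaling_def)

section \<open>General position of random points\<close>

text \<open>Only the base point \<open>x a\<close> is fixed and the coefficients are unconstrained,
  so they can later be perturbed to rational ones without leaving the hull.\<close>

lemma affine_hull_image_eq:
  fixes x :: "'i \<Rightarrow> 'a::real_vector"
  assumes J: "finite J" "a \<in> J"
  shows "affine hull (x ` J) = range (\<lambda>u. x a + (\<Sum>l\<in>J. u l *\<^sub>R (x l - x a)))"
    (is "_ = range ?h")
proof
  have "affine (range ?h)"
    unfolding affine_def
  proof (intro ballI allI impI)
    fix p q and s t :: real
    assume "p \<in> range ?h" "q \<in> range ?h" and st: "s + t = 1"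
    then obtain u w where uw: "p = ?h u" "q = ?h w" by auto
    have "s *\<^sub>R p + t *\<^sub>R q = (s + t) *\<^sub>R x a + (\<Sum>l\<in>J. (s * u l + t * w l) *\<^sub>R (x l - x a))"
      by (simp add: uw algebra_simps scaleR_sum_right sum.distrib sum_subtractf)
    also have "\<dots> = ?h (\<lambda>l. s * u l + t * w l)"
      by (simp only: st scaleR_one)
    finally show "s *\<^sub>R p + t *\<^sub>R q \<in> range ?h" by auto
  qed
  moreover have "x ` J \<subseteq> range ?h"
  proof
    fix y assume "y \<in> x ` J"
    then obtain l where l: "l \<in> J" "y = x l" by auto
    have "?h (\<lambda>i. if i = l then 1 else 0) = x a + (\<Sum>i\<in>J. if i = l then x i - x a else 0)"
      by (intro arg_cong2[where f = "(+)"] sum.cong) auto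
    then have "y = ?h (\<lambda>i. if i = l then 1 else 0)"
      using l J by simp
    then show "y \<in> range ?h" by (rule range_eqI[of y ?h "\<lambda>i. if i = l then 1 else 0"])
  qed
  ultimately show "affine hull (x ` J) \<subseteq> range ?h"
    by (rule hull_minimal[rotated])
  have a: "x a \<in> affine hull (x ` J)"
    using J by (auto intro: hull_inc)
  have sub: "subspace ((\<lambda>y. - x a + y) ` (affine hull (x ` J)))"
    by (rule affine_diffs_subspace[OF affine_affine_hull a])
  show "range ?h \<subseteq> affine hull (x ` J)"
  proof clarify
    fix u
    have "(\<Sum>l\<in>J. u l *\<^sub>R (x l - x a)) \<in> (\<lambda>y. - x a + y) ` (affine hull (x ` J))"
      by (intro subspace_sum[OF sub] subspace_scale[OF sub]) (auto simp: image_iff intro!: bexI hull_inc)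
    then show "?h u \<in> affine hull (x ` J)" by auto
  qed
qed

text \<open>Countably many coefficient vectors suffice for approximation, which lets a degenerate
  event be enclosed in a measurable one.\<close>

lemma rational_combination_dense:
  fixes y :: "'i \<Rightarrow> 'a::real_normed_vector"
  assumes "finite J" "e > 0"
  obtains q where "q \<in> J \<rightarrow>\<^sub>E \<rat>" "norm ((\<Sum>l\<in>J. u l *\<^sub>R y l) - (\<Sum>l\<in>J. q l *\<^sub>R y l)) < e"
proof -
  \<comment> \<open>The extra 1 keeps \<open>B\<close> positive when all \<open>y l\<close> vanish
    and makes the final estimate strict.\<close>
  define B where "B = (\<Sum>l\<in>J. norm (y l)) + 1"
  have B: "B > 0" unfolding B_def by (intro add_nonneg_pos sum_nonneg) auto
  have "\<exists>r\<in>\<rat>. \<bar>u l - r\<bar> < e / B" for l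
  proof -
    obtain r where "r \<in> \<rat>" "u l - e / B < r" "r < u l"
      using Rats_dense_in_real[of "u l - e / B" "u l"] B assms by auto
    then show ?thesis by (intro bexI[of _ r]) auto
  qed
  then obtain r where r: "\<And>l. r l \<in> \<rat>" "\<And>l. \<bar>u l - r l\<bar> < e / B" by metis
  let ?q = "restrict r J"
  have "norm ((\<Sum>l\<in>J. u l *\<^sub>R y l) - (\<Sum>l\<in>J. ?q l *\<^sub>R y l)) = norm (\<Sum>l\<in>J. (u l - r l) *\<^sub>R y l)"
    by (simp add: sum_subtractf[symmetric] scaleR_diff_left)
  also have "\<dots> \<le> (\<Sum>l\<in>J. (e / B) * norm (y l))"
  proof (rule sum_norm_le)
    fix l
    show "norm ((u l - r l) *\<^sub>R y l) \<le> e / B * norm (y l)"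
      using less_imp_le[OF r(2)] by (simp only: norm_scaleR) (intro mult_right_mono, auto)
  qed
  also have "\<dots> = e / B * (B - 1)" by (simp only: B_def sum_distrib_left[symmetric]) simp
  also have "\<dots> < e" using B assms by (simp add: field_simps)
  finally show ?thesis using that[of ?q] r(1) by auto
qed

text \<open>At most \<open>DIM('a)\<close> points span a flat of smaller dimension, which lies in a
  hyperplane.\<close>

lemma emeasure_affine_hull_few_points:
  fixes M :: "'a::euclidean_space measure"
  assumes ac: "\<And>A. A \<in> sets borel \<Longrightarrow> emeasure lborel A = 0 \<Longrightarrow> emeasure M A = 0"
    and T: "finite T" "card T \<le> DIM('a)"
  shows "emeasure M (affine hull T) = 0"
proof (rule ac)
  have "closed (affine hull T)"
    using T by (simp add: closed_affine_hull)
  then show B: "affine hull T \<in> sets borel" by simp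
  have "aff_dim T < int DIM('a)"
    using aff_dim_le_card[OF T(1)] T(2) by linarith
  then obtain a b where "a \<noteq> 0" "T \<subseteq> {x. a \<bullet> x = b}"
    using aff_lowdim_subset_hyperplane by blast
  then have "negligible (affine hull T)"
    using negligible_hyperplane[of a b] hull_minimal[of T "{x. a \<bullet> x = b}" affine, OF _ affine_hyperplane]
      negligible_subset by blast
  then show "emeasure lborel (affine hull T) = 0"
    using B by (simp add: negligible_iff_emeasure0)
qed

text \<open>Fubini in coordinate \<open>i\<close>: once the other points are fixed,
  \<open>X i\<close> has to avoid a null flat. The bad event is enclosed in a measurable set
  \<open>N\<close> whose sections still lie inside that flat.\<close>

lemma AE_not_in_affine_hull:
  fixes M :: "'a::euclidean_space measure"
  assumes sf: "sigma_finite_measure M" and sets: "sets M = sets borel"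
    and ac: "\<And>A. A \<in> sets borel \<Longrightarrow> emeasure lborel A = 0 \<Longrightarrow> emeasure M A = 0"
    and I: "finite I" "i \<in> I" and J: "J \<subseteq> I - {i}" "card J \<le> DIM('a)"
  shows "AE X in (\<Pi>\<^sub>M i\<in>I. M). X i \<notin> affine hull (X ` J)"
proof (cases "J = {}")
  case False
  then obtain a where a: "a \<in> J" by auto
  have finJ: "finite J" using I J finite_subset by blast
  interpret sigma_finite_measure M by fact
  interpret product_sigma_finite "\<lambda>_. M" ..
  have [measurable_cong]: "sets M = sets borel" by fact
  let ?P = "\<Pi>\<^sub>M i\<in>I. M"
  let ?h = "\<lambda>u X. X a + (\<Sum>l\<in>J. u l *\<^sub>R (X l - X a))"
  let ?U = "J \<rightarrow>\<^sub>E (\<rat> :: real set)"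
  have cU: "countable ?U" by (intro countable_PiE finJ) (simp add: countable_rat)
  \<comment> \<open>Arbitrarily good approximation by rational combinations is a condition built
    from countable unions and intersections.\<close>
  define N where "N = {X \<in> space ?P. \<forall>m::nat. \<exists>u\<in>?U. norm (X i - ?h u X) < 1 / real (Suc m)}"
  have JI[measurable]: "l \<in> J \<Longrightarrow> (\<lambda>X. X l) \<in> borel_measurable ?P" for l
    using J by (auto intro!: measurable_component_singleton[of l I "\<lambda>_. M", unfolded measurable_cong_sets[OF refl sets]])
  have iI[measurable]: "(\<lambda>X. X i) \<in> borel_measurable ?P"
    using I by (auto intro!: measurable_component_singleton[of i I "\<lambda>_. M", unfolded measurable_cong_sets[OF refl sets]])
  have hm[measurable]: "?h u \<in> borel_measurable ?P" for u
    using a by (intro borel_measurable_add borel_measurable_sum borel_measurable_scaleR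
        borel_measurable_diff JI) auto
  have "N = (\<Inter>m::nat. \<Union>u\<in>?U. {X \<in> space ?P. norm (X i - ?h u X) < 1 / real (Suc m)})"
    unfolding N_def by auto
  also have "\<dots> \<in> sets ?P"
  proof -
    have "{X \<in> space ?P. norm (X i - ?h u X) < 1 / real (Suc m)} \<in> sets ?P" for u m
      by measurable
    then show ?thesis by (intro sets.countable_INT') (auto intro!: sets.countable_UN'[OF cU])
  qed
  finally have N: "N \<in> sets ?P" .
  have sup: "X \<in> N" if X: "X \<in> space ?P" "X i \<in> affine hull (X ` J)" for X
  proof -
    obtain u where u: "X i = ?h u X"
      using X(2) affine_hull_image_eq[OF finJ a, of X] by auto
    have "\<exists>q\<in>?U. norm (X i - ?h q X) < 1 / real (Suc m)" for m :: nat
    proof -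
      obtain q where q: "q \<in> ?U" "norm ((\<Sum>l\<in>J. u l *\<^sub>R (X l - X a)) - (\<Sum>l\<in>J. q l *\<^sub>R (X l - X a)))
          < 1 / real (Suc m)"
        by (rule rational_combination_dense[OF finJ, of "1 / real (Suc m)" u "\<lambda>l. X l - X a"]) auto
      then show ?thesis by (intro bexI[of _ q]) (simp_all add: u)
    qed
    then show ?thesis using X(1) by (simp add: N_def)
  qed
  have sec: "x \<in> affine hull (X ` J)" if "X(i := x) \<in> N" for x X
  proof -
    have eq: "?h u (X(i := x)) = ?h u X" for u
      using J a by (auto intro!: sum.cong)
    \<comment> \<open>A point approximated arbitrarily well lies in the closure of the affine hull,
      which is the hull itself.\<close>
    have "x \<in> closure (affine hull (X ` J))"
    proof (subst closure_approachable, intro allI impI)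
      fix e :: real assume "e > 0"
      then obtain m where m: "1 / real (Suc m) < e" using nat_approx_posE by blast
      have "\<exists>u. norm ((X(i := x)) i - ?h u (X(i := x))) < 1 / real (Suc m)"
        using that unfolding N_def by blast
      then obtain u where "norm (x - ?h u X) < 1 / real (Suc m)"
        unfolding eq by auto
      then have "dist (?h u X) x < e" using m by (simp add: dist_norm norm_minus_commute)
      then show "\<exists>y\<in>affine hull (X ` J). dist y x < e"
        using affine_hull_image_eq[OF finJ a, of X] by blast
    qed
    then show ?thesis by (simp add: closed_affine_hull)
  qed
  have ins: "insert i (I - {i}) = I" using I by auto
  have "emeasure ?P N = (\<integral>\<^sup>+X. indicator N X \<partial>(\<Pi>\<^sub>M i\<in>insert i (I - {i}). M))"
    unfolding ins using N by simp
  also have "\<dots> = (\<integral>\<^sup>+X. \<integral>\<^sup>+x. indicator N (X(i := x)) \<partial>M \<partial>(\<Pi>\<^sub>M i\<in>I - {i}. M))"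
    by (rule product_nn_integral_insert) (use I N in \<open>auto simp only: ins finite_Diff intro!: borel_measurable_indicator\<close>)
  also have "\<dots> = (\<integral>\<^sup>+X. 0 \<partial>(\<Pi>\<^sub>M i\<in>I - {i}. M))"
  proof (rule nn_integral_cong)
    fix X
    have "(\<integral>\<^sup>+x. indicator N (X(i := x)) \<partial>M) \<le> (\<integral>\<^sup>+x. indicator (affine hull (X ` J)) x \<partial>M)"
      by (intro nn_integral_mono) (auto simp: indicator_def dest: sec)
    also have "\<dots> = emeasure M (affine hull (X ` J))"
      by (subst nn_integral_indicator) (auto simp: sets closed_affine_hull)
    also have "\<dots> = 0"
      using finJ J(2) card_image_le[OF finJ, of X] by (intro emeasure_affine_hull_few_points[OF ac]) auto
    finally show "(\<integral>\<^sup>+x. indicator N (X(i := x)) \<partial>M) = 0" by simp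
  qed
  finally have "N \<in> null_sets ?P" using N by auto
  then show ?thesis
    by (rule AE_I') (auto dest: sup)
qed auto

text \<open>\<open>j + 2\<close> points on a \<open>j\<close>-dimensional flat are affinely
  dependent, so one lies in the affine hull of the other \<open>j + 1\<close>, which are at most
  \<open>DIM('a)\<close> many. Injectivity is the case of a one-point \<open>J\<close>.\<close>

lemma general_position_image:
  fixes X :: "nat \<Rightarrow> 'a::euclidean_space"
  assumes I: "finite I"
    and X: "\<And>i J. i \<in> I \<Longrightarrow> J \<subseteq> I - {i} \<Longrightarrow> card J \<le> DIM('a) \<Longrightarrow> X i \<notin> affine hull (X ` J)"
  shows "inj_on X I" "general_position (X ` I)"
proof -
  show inj: "inj_on X I"
  proof (rule inj_onI, rule ccontr)
    fix i j assume ij: "i \<in> I" "j \<in> I" "X i = X j" "i \<noteq> j"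
    then have "X i \<notin> affine hull (X ` {j})" by (intro X) (auto simp: Suc_leI)
    then show False using ij by simp
  qed
  have False
    if T: "T \<subseteq> X ` I" "card T = j + 2" and j: "j \<in> {1..DIM('a) - 1}"
      and A: "aff_dim A = int j" "T \<subseteq> A" for T A j
  proof -
    have finT: "finite T" using T I finite_subset by blast
    have "aff_dim T \<le> int j" using aff_dim_subset[OF A(2)] A(1) by simp
    then have "affine_dependent T"
      using affine_independent_iff_card[of T] T(2) finT by auto
    then obtain x where x: "x \<in> T" "x \<in> affine hull (T - {x})"
      by (auto simp: affine_dependent_def)
    then obtain i where i: "i \<in> I" "x = X i" using T by auto
    define J where "J = {l \<in> I. X l \<in> T - {x}}"
    have im: "X ` J = T - {x}" using T by (auto simp: J_def)
    have "inj_on X J" using inj by (rule inj_on_subset) (auto simp: J_def)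
    then have "card J = card (T - {x})" using im card_image by metis
    also have "\<dots> \<le> DIM('a)" using T x finT j by auto
    finally have "X i \<notin> affine hull (X ` J)"
      using i by (intro X) (auto simp: J_def)
    then show False using x i im by simp
  qed
  then show "general_position (X ` I)"
    unfolding general_position_def using I by blast
qed

lemma AE_general_position:
  fixes M :: "'a::euclidean_space measure"
  assumes "sigma_finite_measure M" "sets M = sets borel"
    and "\<And>A. A \<in> sets borel \<Longrightarrow> emeasure lborel A = 0 \<Longrightarrow> emeasure M A = 0"
  shows "AE X in (\<Pi>\<^sub>M i\<in>{..<n::nat}. M). inj_on X {..<n} \<and> general_position (X ` {..<n})"
proof -
  have "AE X in (\<Pi>\<^sub>M i\<in>{..<n}. M). \<forall>i\<in>{..<n}. \<forall>J\<in>{J. J \<subseteq> {..<n} - {i} \<and> card J \<le> DIM('a)}.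
      X i \<notin> affine hull (X ` J)"
    by (intro AE_finite_allI AE_not_in_affine_hull[OF assms])
      (auto intro: finite_subset[of _ "Pow {..<n}"])
  then show ?thesis
    by eventually_elim (auto intro!: general_position_image)
qed

section \<open>Inscribed parallelotopes\<close>

lemma emeasure_lborel_cbox_cart:
  fixes a b :: "real ^ 'd"
  assumes "\<And>i. a $ i \<le> b $ i"
  shows "emeasure lborel (cbox a b) = ennreal (\<Prod>i\<in>UNIV. b $ i - a $ i)"
proof -
  have "cbox a b \<noteq> {}" using assms by (simp add: interval_ne_empty_cart)
  then show ?thesis
    using emeasure_lborel_cbox_finite[of a b] content_cbox_cart[of a b]
    by (simp add: emeasure_eq_ennreal_measure less_top)
qed

text \<open>Makes the vertex tuples chosen from \<open>K\<close> a compact domain for the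
  determinant.\<close>

lemma compact_Collect_vec_components:
  fixes K :: "'a::euclidean_space set"
  assumes "compact K"
  shows "compact {A :: 'a ^ 'n. \<forall>i. A $ i \<in> K}"
proof -
  have "{A :: 'a ^ 'n. \<forall>i. A $ i \<in> K} = (\<Inter>i. (\<lambda>A. A $ i) -` K)" by auto
  also have "closed \<dots>"
    using assms by (intro closed_INT ballI closed_vimage compact_imp_closed continuous_intros) auto
  finally have "closed {A :: 'a ^ 'n. \<forall>i. A $ i \<in> K}" .
  moreover obtain B where B: "\<And>x. x \<in> K \<Longrightarrow> norm x \<le> B"
    using compact_imp_bounded[OF assms] by (auto simp: bounded_iff)
  have "norm A \<le> real CARD('n) * B" if "\<forall>i. A $ i \<in> K" for A :: "'a ^ 'n"
  proof -
    have "norm A \<le> (\<Sum>i\<in>UNIV. norm (A $ i))"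
      unfolding norm_vec_def by (rule L2_set_le_sum) auto
    also have "\<dots> \<le> (\<Sum>i\<in>(UNIV :: 'n set). B)"
      by (intro sum_mono B) (use that in auto)
    finally show ?thesis by simp
  qed
  then have "bounded {A :: 'a ^ 'n. \<forall>i. A $ i \<in> K}"
    by (intro boundedI) auto
  ultimately show ?thesis by (simp add: compact_eq_bounded_closed)
qed

text \<open>
  A simplex of maximal volume with one vertex at \<open>v\<close>: exchanging a vertex for \<open>x \<in> K\<close> multiplies the
  determinant by the corresponding coordinate of \<open>x\<close>, which is therefore at most 1.
\<close>

lemma max_simplex_coordinates:
  fixes K :: "(real ^ 'd) set"
  assumes K: "compact K" and v: "v \<in> interior K"
  shows "\<exists>e :: 'd \<Rightarrow> real ^ 'd. (\<forall>i. v + e i \<in> K) \<and> bij (\<lambda>w. \<Sum>i\<in>UNIV. w $ i *\<^sub>R e i) \<and>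
    (\<forall>x\<in>K. \<exists>w. (\<forall>i. \<bar>w $ i\<bar> \<le> 1) \<and> x = v + (\<Sum>i\<in>UNIV. w $ i *\<^sub>R e i))"
proof -
  let ?S = "{A :: real ^ 'd ^ 'd. \<forall>i. A $ i \<in> K}"
  let ?M = "\<lambda>A :: real ^ 'd ^ 'd. \<chi> i. A $ i - v"
  let ?f = "\<lambda>A. \<bar>det (?M A)\<bar>"
  have cont: "continuous_on ?S ?f"
    unfolding det_def by (intro continuous_intros)
  have "v \<in> K" using v interior_subset by blast
  then have "(\<chi> i. v) \<in> ?S" by simp
  then obtain A where A: "A \<in> ?S" "\<And>B. B \<in> ?S \<Longrightarrow> ?f B \<le> ?f A"
    using continuous_attains_sup[OF compact_Collect_vec_components[OF K] _ cont] by blast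
  obtain \<rho> where \<rho>: "\<rho> > 0" "cball v \<rho> \<subseteq> K"
    using v mem_interior_cball by blast
  \<comment> \<open>A small simplex with edges along the axes fits in \<open>K\<close>, so the
    maximal determinant is nonzero.\<close>
  have "?f (\<chi> i. v + \<rho> *\<^sub>R axis i 1) \<le> ?f A"
    by (rule A) (use \<rho> in \<open>auto simp: dist_norm subset_eq\<close>)
  moreover have "(?M (\<chi> i. v + \<rho> *\<^sub>R axis i 1)) = \<rho> *\<^sub>R mat 1"
    by (simp add: vec_eq_iff axis_def mat_def)
  moreover have "det (\<rho> *\<^sub>R mat 1 :: real ^ 'd ^ 'd) = \<rho> ^ CARD('d)"
    by (subst det_diagonal) (auto simp: mat_def)
  ultimately have "?f A > 0"
    using \<rho>(1) by (smt (verit) zero_less_power)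
  then have nz: "det (?M A) \<noteq> 0" by simp
  define e where "e i = A $ i - v" for i
  let ?F = "\<lambda>w :: real ^ 'd. \<Sum>i\<in>UNIV. w $ i *\<^sub>R e i"
  have F: "?F = (*v) (transpose (?M A))"
    by (rule ext) (simp add: vec_eq_iff matrix_vector_mult_def transpose_def e_def mult.commute)
  have "invertible (transpose (?M A))"
    using nz by (simp only: invertible_det_nz det_transpose not_False_eq_True)
  then have "bij ((*v) (transpose (?M A)))"
    by (simp only: invertible_eq_bij)
  then have bij: "bij ?F" by (simp only: F)
  show ?thesis
  proof (intro exI[of _ e] conjI allI ballI)
    show "v + e i \<in> K" for i using A(1) by (simp add: e_def)
    show "bij ?F" by fact
    fix x assume x: "x \<in> K"
    have "x - v \<in> range ?F" by (simp only: bij_is_surj[OF bij] UNIV_I)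
    then obtain w where w: "x - v = ?F w" by (rule imageE)
    have row: "row i (?M A) = e i" for i
      by (simp add: row_def e_def vec_eq_iff)
    have "\<bar>w $ k\<bar> \<le> 1" for k
    proof -
      have "?f (\<chi> i. if i = k then x else A $ i) \<le> ?f A"
        by (rule A(2)) (use x A(1) in auto)
      also have "?M (\<chi> i. if i = k then x else A $ i)
          = (\<chi> i. if i = k then (\<Sum>i\<in>UNIV. w $ i *s row i (?M A)) else row i (?M A))"
        unfolding row scalar_mult_eq_scaleR w[symmetric]
        by (rule Cart_lambda_cong) (simp add: e_def)
      also have "det \<dots> = w $ k * det (?M A)"
        by (rule cramer_lemma_transpose)
      finally have "\<bar>w $ k\<bar> * \<bar>det (?M A)\<bar> \<le> 1 * \<bar>det (?M A)\<bar>"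
        by (simp only: abs_mult mult_1)
      then show ?thesis
        by (rule mult_right_le_imp_le) (use nz in simp)
    qed
    then show "\<exists>w. (\<forall>i. \<bar>w $ i\<bar> \<le> 1) \<and> x = v + ?F w"
      using w by (intro exI[of _ w]) (simp only: w[symmetric], simp)
  qed
qed

text \<open>Two consequences of the maximal simplex. Convexity puts a parallelotope whose edges are
  the \<open>e i\<close> divided by the dimension inside \<open>K\<close>. And \<open>K\<close> lies
  in the one with coordinates in \<open>[-1, 1]\<close>, so its unit volume keeps the
  \<open>e i\<close> from spanning too little volume.\<close>

lemma inscribed_parallelotope:
  fixes K :: "(real ^ 'd) set"
  assumes K: "convex_body K" "emeasure lborel K = 1" and Q: "Q > 0"
  obtains v F D where "linear F" "bij F" "volume_scaling (\<lambda>x. v + F x) D"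
    "(\<lambda>x. v + F x) ` cbox (\<chi> i. - Q) (\<chi> i. Q) \<subseteq> K"
    "D \<ge> (1 / (4 * real CARD('d) * Q)) ^ CARD('d)"
proof -
  define d where "d = real CARD('d)"
  have d: "d > 0" by (simp add: d_def)
  obtain v where v: "v \<in> interior K" using K by (auto simp: convex_body_def)
  have vK: "v \<in> K" and cK: "convex K" "compact K"
    using v interior_subset K by (auto simp: convex_body_def)
  have "\<exists>e :: 'd \<Rightarrow> real ^ 'd. (\<forall>i. v + e i \<in> K) \<and> bij (\<lambda>w. \<Sum>i\<in>UNIV. w $ i *\<^sub>R e i) \<and>
    (\<forall>x\<in>K. \<exists>w. (\<forall>i. \<bar>w $ i\<bar> \<le> 1) \<and> x = v + (\<Sum>i\<in>UNIV. w $ i *\<^sub>R e i))"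
    by (rule max_simplex_coordinates[OF cK(2) v])
  then obtain e :: "'d \<Rightarrow> real ^ 'd" where e': "(\<forall>i. v + e i \<in> K) \<and> bij (\<lambda>w. \<Sum>i\<in>UNIV. w $ i *\<^sub>R e i) \<and>
    (\<forall>x\<in>K. \<exists>w. (\<forall>i. \<bar>w $ i\<bar> \<le> 1) \<and> x = v + (\<Sum>i\<in>UNIV. w $ i *\<^sub>R e i))" ..
  note e = e'[THEN conjunct1, rule_format] e'[THEN conjunct2, THEN conjunct1]
    e'[THEN conjunct2, THEN conjunct2, rule_format]
  \<comment> \<open>Coordinates in \<open>[- Q, Q]\<close> are shrunk to
    \<open>[- 1 / (2 * d), 1 / (2 * d)]\<close>.\<close>
  define \<sigma> where "\<sigma> = 1 / (2 * d * Q)"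
  have \<sigma>: "\<sigma> > 0" using d Q by (simp add: \<sigma>_def)
  define F where "F = (\<lambda>w :: real ^ 'd. \<Sum>i\<in>UNIV. (\<sigma> * w $ i) *\<^sub>R e i)"
  have lin: "linear F"
    unfolding F_def
    by (rule linearI) (simp_all add: distrib_left scaleR_add_left sum.distrib scaleR_sum_right mult.left_commute)
  have "bij (\<lambda>w :: real ^ 'd. \<sigma> *\<^sub>R w)"
    by (rule bij_betw_byWitness[where f' = "\<lambda>w. (1 / \<sigma>) *\<^sub>R w"]) (use \<sigma> in auto)
  from bij_comp[OF this e(2)] have bij: "bij F"
    by (simp add: F_def o_def)
  \<comment> \<open>The centre of the inner parallelotope, whose coordinates run over
    \<open>[0, 1 / d]\<close>.\<close>
  define p where "p = v + (\<Sum>i\<in>UNIV. (1 / (2 * d)) *\<^sub>R e i)"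
  obtain D where D: "volume_scaling (\<lambda>x. p + F x) D"
    using affine_bij_volume_scaling[OF lin bij] by blast
  have sub: "p + F w \<in> K" if w: "w \<in> cbox (\<chi> i. - Q) (\<chi> i. Q)" for w
  proof -
    \<comment> \<open>\<open>p + F w\<close> is the average over \<open>i\<close> of points on the
      segments from \<open>v\<close> to \<open>v + e i\<close>; this number is the position on the
      \<open>i\<close>-th segment.\<close>
    have "(1/2 + d * \<sigma> * w $ i) \<in> {0..1}" for i
    proof -
      have "- Q \<le> w $ i" "w $ i \<le> Q" using w by (auto simp: mem_box_cart)
      moreover have eq: "d * \<sigma> * w $ i = w $ i / (2 * Q)" using d by (simp add: \<sigma>_def)
      ultimately show ?thesis unfolding eq using Q by (simp add: divide_simps)
    qed
    moreover have "v + u *\<^sub>R e i \<in> K" if "u \<in> {0..1}" for u i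
    proof -
      have "(1 - u) *\<^sub>R v + u *\<^sub>R (v + e i) \<in> K"
        using that by (intro convexD_alt[OF cK(1) vK e(1)]) auto
      then show ?thesis by (simp add: scaleR_diff_left scaleR_add_right)
    qed
    ultimately have "v + (1/2 + d * \<sigma> * w $ i) *\<^sub>R e i \<in> K" for i
      by blast
    then have "(\<Sum>i\<in>(UNIV :: 'd set). (1 / d) *\<^sub>R (v + (1/2 + d * \<sigma> * w $ i) *\<^sub>R e i)) \<in> K"
      by (intro convex_sum[OF _ cK(1)]) (auto simp: d_def)
    moreover have "(\<Sum>i\<in>(UNIV :: 'd set). (1 / d) *\<^sub>R (v + (1/2 + d * \<sigma> * w $ i) *\<^sub>R e i))
      = (\<Sum>i\<in>(UNIV :: 'd set). (1 / d) *\<^sub>R v) + (\<Sum>i\<in>UNIV. (1 / (2 * d)) *\<^sub>R e i + (\<sigma> * w $ i) *\<^sub>R e i)"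
      unfolding sum.distrib[symmetric]
    proof (intro sum.cong refl)
      fix i
      have "(1 / d) * (1/2 + d * \<sigma> * w $ i) = 1 / (2 * d) + \<sigma> * w $ i"
        using d by (simp add: field_simps)
      then show "(1 / d) *\<^sub>R (v + (1/2 + d * \<sigma> * w $ i) *\<^sub>R e i)
          = (1 / d) *\<^sub>R v + ((1 / (2 * d)) *\<^sub>R e i + (\<sigma> * w $ i) *\<^sub>R e i)"
        by (simp only: scaleR_add_right scaleR_scaleR flip: scaleR_add_left)
    qed
    moreover have "(\<Sum>i\<in>(UNIV :: 'd set). (1 / d) *\<^sub>R v) = v"
      by (simp only: d_def sum_constant_scaleR scaleR_scaleR) simp
    ultimately show ?thesis by (simp add: p_def F_def sum.distrib add.assoc)
  qed
  have Dlower: "D \<ge> (\<sigma> / 2) ^ CARD('d)"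
  proof -
    \<comment> \<open>\<open>F q = p - v\<close>, so \<open>q\<close> moves the origin from
      \<open>p\<close> back to \<open>v\<close>.\<close>
    define q :: "real ^ 'd" where "q = (\<chi> i. 1 / (2 * d * \<sigma>))"
    let ?B = "cbox ((\<chi> i. - (1 / \<sigma>)) - q) ((\<chi> i. 1 / \<sigma>) - q)"
    have "K \<subseteq> (\<lambda>x. p + F x) ` ?B"
    proof
      fix x assume "x \<in> K"
      then obtain w where w: "\<And>i. \<bar>w $ i\<bar> \<le> 1" "x = v + (\<Sum>i\<in>UNIV. w $ i *\<^sub>R e i)"
        using e(3)[OF \<open>x \<in> K\<close>] by blast
      let ?u = "(1 / \<sigma>) *\<^sub>R w - q"
      have "?u \<in> ?B"
        unfolding mem_box_cart
      proof
        fix i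
        have "- 1 \<le> w $ i" "w $ i \<le> 1" using w(1)[of i] by auto
        then have "- 1 / \<sigma> \<le> w $ i / \<sigma>" "w $ i / \<sigma> \<le> 1 / \<sigma>"
          using \<sigma> by (simp_all only: divide_right_mono less_imp_le)
        then show "((\<chi> i. - (1 / \<sigma>)) - q) $ i \<le> ?u $ i \<and> ?u $ i \<le> ((\<chi> i. 1 / \<sigma>) - q) $ i"
          by simp
      qed
      moreover have "\<sigma> * ?u $ i = w $ i - 1 / (2 * d)" for i
        using \<sigma> d by (simp add: q_def field_simps)
      then have "x = p + F ?u"
        by (simp only: F_def p_def w(2)) (simp add: scaleR_diff_left sum_subtractf)
      ultimately show "x \<in> (\<lambda>x. p + F x) ` ?B" by blast
    qed
    moreover have "(\<lambda>x. p + F x) ` ?B \<in> sets borel"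
      and vol: "emeasure lborel ((\<lambda>x. p + F x) ` ?B) = ennreal D * emeasure lborel ?B"
      using D unfolding volume_scaling_def by auto
    ultimately have "1 \<le> ennreal D * emeasure lborel ?B"
      using emeasure_mono[of K "(\<lambda>x. p + F x) ` ?B" lborel] K(2) vol by simp
    also have "emeasure lborel ?B = ennreal ((2 / \<sigma>) ^ CARD('d))"
      by (subst emeasure_lborel_cbox_cart) (use \<sigma> in auto)
    also have "ennreal D * \<dots> = ennreal (D * (2 / \<sigma>) ^ CARD('d))"
      by (rule ennreal_mult'[symmetric]) (use D in \<open>simp add: volume_scaling_def\<close>)
    finally have "1 \<le> D * (2 / \<sigma>) ^ CARD('d)"
      by simp
    then show ?thesis using \<sigma> by (simp add: power_divide pos_divide_le_eq mult.commute)
  qed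
  show thesis
  proof (rule that[OF lin bij D])
    show "(\<lambda>x. p + F x) ` cbox (\<chi> i. - Q) (\<chi> i. Q) \<subseteq> K" using sub by blast
    have "\<sigma> / 2 = 1 / (4 * real CARD('d) * Q)" by (simp add: \<sigma>_def d_def)
    then show "(1 / (4 * real CARD('d) * Q)) ^ CARD('d) \<le> D" using Dlower by (simp only:)
  qed
qed

section \<open>Slabs around sheared hyperplanes\<close>

lemma convex_position_affine_image:
  fixes F :: "'a::euclidean_space \<Rightarrow> 'a"
  assumes F: "linear F" "inj F" and A: "convex_position A"
  shows "convex_position ((\<lambda>x. v + F x) ` A)"
  unfolding convex_position_def
proof (intro conjI ballI notI)
  let ?T = "\<lambda>x. v + F x"
  have T: "inj ?T" using F(2) by (auto simp: inj_def)
  show "finite (?T ` A)" using A by (simp add: convex_position_def)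
  fix x assume x: "x \<in> ?T ` A" and hull: "x \<in> convex hull (?T ` A - {x})"
  obtain a where a: "a \<in> A" "x = ?T a" using x by auto
  have "?T ` A - {x} = ?T ` (A - {a})" using a T by (auto simp: inj_def)
  also have "\<dots> = (+) v ` F ` (A - {a})" by (simp add: image_image)
  also have "convex hull \<dots> = ?T ` (convex hull (A - {a}))"
    unfolding convex_hull_translation convex_hull_linear_image[OF F(1), symmetric]
    by (simp add: image_image)
  finally obtain b where "b \<in> convex hull (A - {a})" "?T a = ?T b" using hull a(2) by auto
  then have "a \<in> convex hull (A - {a})" using injD[OF T] by metis
  then show False using A a(1) by (simp add: convex_position_def)
qed

text \<open>A point of \<open>S\<close> in the hull lies in \<open>C\<close>, hence in
  \<open>T\<close>, but points in convex position are extreme in their hull and so not interior. It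
  therefore suffices to keep the rest of the sample out of some convex \<open>C\<close> around
  \<open>T\<close>.\<close>

lemma is_hole_in_convex_set:
  fixes T :: "'a::euclidean_space set"
  assumes "general_position S" and T: "T \<subseteq> S" "card T = k" "convex_position T"
    and C: "convex C" "T \<subseteq> C" "C \<inter> S \<subseteq> T"
  shows "is_hole k S T"
proof -
  have "interior (convex hull T) \<inter> S = {}"
  proof (rule ccontr)
    assume "interior (convex hull T) \<inter> S \<noteq> {}"
    then obtain x where x: "x \<in> interior (convex hull T)" "x \<in> S" by blast
    have "x \<in> C" using x(1) interior_subset hull_minimal[of T C convex] C by blast
    then have "x \<in> T" using x(2) C(3) by blast
    then have "x extreme_point_of (convex hull T)"
      using T(3) extreme_point_of_convex_hull_convex_independent[of T x]
      by (auto simp: convex_position_def finite_imp_compact)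
    then show False using extreme_point_not_in_interior x(1) by blast
  qed
  then show ?thesis using assms by (simp add: is_hole_def)
qed

text \<open>
  The graphs \<open>w $ z = tilt z t w\<close> are the hyperplanes not parallel to the axis \<open>z\<close>;
  the coefficient \<open>t z\<close> is the constant term.
\<close>

definition tilt :: "'d::finite \<Rightarrow> ('d \<Rightarrow> real) \<Rightarrow> real ^ 'd \<Rightarrow> real"
  where "tilt z t w = t z + (\<Sum>i\<in>UNIV - {z}. t i * w $ i)"

text \<open>Carries \<open>w $ z = 0\<close> onto the graph of \<open>tilt z t\<close> and keeps all
  other coordinates; the latter allows centres to be recognized after shearing.\<close>

definition shear :: "'d::finite \<Rightarrow> ('d \<Rightarrow> real) \<Rightarrow> real ^ 'd \<Rightarrow> real ^ 'd"
  where "shear z t w = (\<chi> i. if i = z then w $ z + tilt z t w else w $ i)"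

lemma shear_nth: "shear z t w $ i = (if i = z then w $ z + tilt z t w else w $ i)"
  by (simp add: shear_def)

lemma tilt_cong:
  assumes "\<And>i. i \<noteq> z \<Longrightarrow> v $ i = w $ i"
  shows "tilt z t v = tilt z t w"
  using assms by (simp add: tilt_def)

lemma tilt_uminus: "tilt z (\<lambda>i. - t i) w = - tilt z t w"
  by (simp add: tilt_def sum_negf)

lemma shear_uminus_shear: "shear z (\<lambda>i. - t i) (shear z t w) = w"
proof -
  have "tilt z t (shear z t w) = tilt z t w"
    by (rule tilt_cong) (simp add: shear_nth)
  then show ?thesis by (simp add: vec_eq_iff shear_nth tilt_uminus)
qed

lemma bij_shear: "bij (shear z t)"
proof (rule bij_betw_byWitness[where f' = "shear z (\<lambda>i. - t i)"])
  show "\<forall>w\<in>UNIV. shear z t (shear z (\<lambda>i. - t i) w) = w"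
    using shear_uminus_shear[of z "\<lambda>i. - t i"] by simp
qed (auto simp: shear_uminus_shear)

lemma shear_affine:
  obtains c G where "linear G" "bij G" "shear z t = (\<lambda>w. c + G w)"
proof -
  define G :: "real ^ 'a \<Rightarrow> real ^ 'a" where "G = shear z (t(z := 0))"
  have "linear G"
    unfolding G_def
    by (rule linearI)
      (auto simp: vec_eq_iff shear_nth tilt_def distrib_left sum.distrib sum_distrib_left mult.left_commute)
  moreover have "shear z t = (\<lambda>w. axis z (t z) + G w)"
    by (auto simp: fun_eq_iff vec_eq_iff shear_nth G_def tilt_def axis_def)
  ultimately show ?thesis using that bij_shear unfolding G_def by metis
qed

text \<open>
  The shear is conjugate to its inverse by the reflection in the coordinate hyperplane,
  so it scales volumes by some \<open>D\<close> with \<open>D\<^sup>2 = 1\<close>.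
\<close>

lemma volume_scaling_shear: "volume_scaling (shear z t) 1"
proof -
  obtain c G where G: "linear G" "bij G" "shear z t = (\<lambda>w. c + G w)"
    by (rule shear_affine)
  obtain D where D: "volume_scaling (shear z t) D"
    using affine_bij_volume_scaling[OF G(1,2), of c] G(3) by metis
  define R :: "real ^ 'a \<Rightarrow> real ^ 'a" where "R w = (\<chi> i. if i = z then - w $ z else w $ i)" for w
  have RR: "R (R w) = w" for w by (simp add: R_def vec_eq_iff)
  have "linear R" by (rule linearI) (auto simp: R_def vec_eq_iff)
  moreover have "bij R" by (rule bij_betw_byWitness[where f' = R]) (auto simp: RR)
  ultimately obtain E where "volume_scaling (\<lambda>w. 0 + R w) E"
    by (rule affine_bij_volume_scaling)
  then have E: "volume_scaling R E" by simp
  have "R \<circ> R = id" by (auto simp: RR)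
  then have "volume_scaling (id :: real ^ 'a \<Rightarrow> _) (E * E)" using volume_scaling_comp[OF E E] by (simp only:)
  then have EE: "E * E = 1" using volume_scaling_unique volume_scaling_id by blast
  have "R (shear z t (R w)) = shear z (\<lambda>i. - t i) w" for w
  proof -
    have "tilt z t (R w) = tilt z t w" by (rule tilt_cong) (simp add: R_def)
    then show ?thesis by (auto simp: vec_eq_iff shear_nth tilt_uminus R_def)
  qed
  then have "R \<circ> (shear z t \<circ> (R \<circ> shear z t)) = id"
    by (auto simp: fun_eq_iff shear_uminus_shear)
  then have "volume_scaling (id :: real ^ 'a \<Rightarrow> _) (E * (D * (E * D)))"
    using volume_scaling_comp[OF E volume_scaling_comp[OF D volume_scaling_comp[OF E D]]] by simp
  then have "E * (D * (E * D)) = 1" using volume_scaling_unique volume_scaling_id by blast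
  then have "(E * E) * D\<^sup>2 = 1" by (simp add: power2_eq_square mult_ac)
  then have "D = 1" using EE D by (simp add: volume_scaling_def power2_eq_1_iff)
  then show ?thesis using D by simp
qed

text \<open>A box around the point over \<open>c\<close> on the paraboloid flattened by
  \<open>h\<close>. The centres used have \<open>c $ z = 0\<close>, so \<open>c \<bullet> c\<close>
  is the squared horizontal norm; the vertical half-width is \<open>h * r\<close>.\<close>

definition cell :: "'d::finite \<Rightarrow> real \<Rightarrow> real \<Rightarrow> real ^ 'd \<Rightarrow> (real ^ 'd) set"
  where "cell z r h c = cbox (\<chi> i. if i = z then h * (c \<bullet> c - r) else c $ i - r)
    (\<chi> i. if i = z then h * (c \<bullet> c + r) else c $ i + r)"

lemma cellD:
  assumes "w \<in> cell z r h c"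
  shows "h * (c \<bullet> c - r) \<le> w $ z" "w $ z \<le> h * (c \<bullet> c + r)"
    and "i \<noteq> z \<Longrightarrow> \<bar>w $ i - c $ i\<bar> \<le> r"
proof -
  have *: "(if i = z then h * (c \<bullet> c - r) else c $ i - r) \<le> w $ i \<and>
      w $ i \<le> (if i = z then h * (c \<bullet> c + r) else c $ i + r)" for i
    using assms by (simp add: cell_def mem_box_cart)
  show "h * (c \<bullet> c - r) \<le> w $ z" "w $ z \<le> h * (c \<bullet> c + r)" using *[of z] by simp_all
  show "\<bar>w $ i - c $ i\<bar> \<le> r" if "i \<noteq> z" using *[of i] that by (simp add: abs_le_iff)
qed

lemma prod_if_eq_const:
  "(\<Prod>i\<in>(UNIV :: 'd::finite set). if i = z then a else b) = a * b ^ (CARD('d) - 1)" for a b :: real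
  by (subst prod.remove[of _ z]) (auto simp: card_Diff_singleton)

lemma emeasure_cell:
  fixes c :: "real ^ 'd"
  assumes "0 < r" "0 < h"
  shows "emeasure lborel (cell z r h c) = ennreal (h * (2 * r) ^ CARD('d))"
proof -
  have "emeasure lborel (cell z r h c) = ennreal (\<Prod>i\<in>(UNIV :: 'd set). if i = z then 2 * h * r else 2 * r)"
    unfolding cell_def using assms
    by (subst emeasure_lborel_cbox_cart) (auto simp: algebra_simps intro!: arg_cong[of _ _ ennreal] prod.cong)
  also have "(\<Prod>i\<in>(UNIV :: 'd set). if i = z then 2 * h * r else 2 * r) = h * ((2 * r) * (2 * r) ^ (CARD('d) - 1))"
    by (simp add: prod_if_eq_const)
  also have "(2 * r) * (2 * r) ^ (CARD('d) - 1) = (2 * r) ^ CARD('d)"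
    by (subst power_Suc[symmetric]) simp
  finally show ?thesis .
qed

lemma Ints_eq_if_dist_less_1:
  fixes a b :: real
  assumes "a \<in> \<int>" "b \<in> \<int>" "\<bar>a - b\<bar> < 1"
  shows "a = b"
  using assms Ints_nonzero_abs_less1[of "a - b"] by auto

text \<open>The origin and the unit vectors allow a hyperplane to be recovered from its cells.
  Multiples of one horizontal unit vector, available in dimension at least 2, fill the set up to
  size \<open>k\<close>.\<close>

lemma exists_integer_centres:
  fixes z :: "'d::finite"
  assumes d: "CARD('d) \<ge> 2" and k: "k \<ge> CARD('d)"
  obtains W :: "(real ^ 'd) set" where "finite W" "card W = k" "0 \<in> W" "\<And>i. i \<noteq> z \<Longrightarrow> axis i 1 \<in> W"
    "\<And>c. c \<in> W \<Longrightarrow> c $ z = 0" "\<And>c i. c \<in> W \<Longrightarrow> c $ i \<in> \<int>"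
    "\<And>c i. c \<in> W \<Longrightarrow> 0 \<le> c $ i" "\<And>c i. c \<in> W \<Longrightarrow> c $ i \<le> real k"
proof -
  define B where "B = insert 0 ((\<lambda>i. axis i (1::real)) ` (UNIV - {z}))"
  have "card B \<le> Suc (card ((\<lambda>i. axis i (1::real)) ` (UNIV - {z})))"
    unfolding B_def by (rule card_insert_le_m1) auto
  also have "\<dots> \<le> Suc (card (UNIV - {z}))" by (simp only: Suc_le_mono card_image_le finite)
  also have "\<dots> \<le> k" using k d by (simp add: card_Diff_singleton)
  finally have B: "card B \<le> k" .
  have "UNIV - {z} \<noteq> {}"
  proof
    assume "UNIV - {z} = {}"
    then have "card (UNIV - {z}) = 0" by (simp only: card.empty)
    then show False using d by (simp add: card_Diff_singleton)
  qed
  then obtain j where j: "j \<noteq> z" by blast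
  define Z where "Z = B \<union> (\<lambda>m. axis j (real m)) ` {..k}"
  have "inj_on (\<lambda>m. axis j (real m)) {..k}"
    by (auto simp: inj_on_def axis_eq_axis)
  then have "card ((\<lambda>m. axis j (real m)) ` {..k}) = Suc k" by (simp add: card_image)
  moreover have finZ: "finite Z" by (simp add: Z_def B_def)
  ultimately have "k \<le> card Z"
    using card_mono[of Z "(\<lambda>m. axis j (real m)) ` {..k}"] by (auto simp: Z_def)
  then obtain W where W: "B \<subseteq> W" "W \<subseteq> Z" "card W = k"
    using exists_subset_between[OF B _ _ finZ] by (auto simp: Z_def)
  have "c $ z = 0 \<and> c $ i \<in> \<int> \<and> 0 \<le> c $ i \<and> c $ i \<le> real k" if "c \<in> Z" for c i
    using that j k d by (auto simp: Z_def B_def axis_def)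
  then show thesis
    using W finZ finite_subset by (intro that[of W]) (auto simp: B_def)
qed

section \<open>A fixed pattern of integer centres and its cells\<close>

locale hole_pattern =
  fixes z :: "'d::finite" and W :: "(real ^ 'd) set" and k :: nat and r :: real
  assumes finite_W: "finite W" and card_W: "card W = k" and k_pos: "k > 0"
    and zero_W: "0 \<in> W" and axis_W: "\<And>i. i \<noteq> z \<Longrightarrow> axis i 1 \<in> W"
    and W_z: "\<And>c. c \<in> W \<Longrightarrow> c $ z = 0" and W_Ints: "\<And>c i. c \<in> W \<Longrightarrow> c $ i \<in> \<int>"
    and W_nonneg: "\<And>c i. c \<in> W \<Longrightarrow> 0 \<le> c $ i" and W_le: "\<And>c i. c \<in> W \<Longrightarrow> c $ i \<le> real k"
    and r_eq: "r = 1 / (8 * real CARD('d) * real k)"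
begin

text \<open>This normalization of \<open>r\<close> controls errors in inner products: at most
  \<open>CARD('d)\<close> coordinates, each of size at most \<open>k\<close>, are perturbed by at
  most \<open>r\<close> each.\<close>

lemma dkr: "real CARD('d) * real k * r = 1 / 8"
  using k_pos by (simp add: r_eq)

lemma r_pos: "0 < r"
  using k_pos by (simp add: r_eq)

lemma r_le: "r \<le> 1 / 8" "real CARD('d) * r \<le> 1 / 8"
proof -
  have "1 * (1 * r) \<le> real CARD('d) * (real k * r)" "real CARD('d) * (1 * r) \<le> real CARD('d) * (real k * r)"
    using k_pos r_pos by (intro mult_mono; simp add: Suc_le_eq)+
  then show "r \<le> 1 / 8" "real CARD('d) * r \<le> 1 / 8" using dkr by (simp_all only: mult.assoc mult_1)
qed

lemma separation:
  assumes "c \<in> W" "c' \<in> W" "c \<noteq> c'"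
  shows "1 \<le> (c - c') \<bullet> (c - c')"
proof -
  obtain i where i: "c $ i \<noteq> c' $ i" using assms(3) by (auto simp: vec_eq_iff)
  then have "1 \<le> \<bar>c $ i - c' $ i\<bar>"
    using Ints_eq_if_dist_less_1[of "c $ i" "c' $ i"] W_Ints assms by force
  then have "1 \<le> \<bar>c $ i - c' $ i\<bar>\<^sup>2" by (rule one_le_power)
  then have "1 \<le> (c $ i - c' $ i)\<^sup>2" by simp
  also have "\<dots> \<le> (\<Sum>i\<in>UNIV. (c $ i - c' $ i)\<^sup>2)"
    by (rule member_le_sum) auto
  finally show ?thesis by (simp add: inner_vec_def power2_eq_square)
qed

text \<open>The vertical coordinate of \<open>w\<close> may be far from that of \<open>c'\<close>,
  but \<open>c $ z = 0\<close> removes it.\<close>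

lemma inner_cell:
  assumes "c \<in> W" "w \<in> cell z r h c'"
  shows "\<bar>c \<bullet> w - c \<bullet> c'\<bar> \<le> 1 / 8"
proof -
  have "c \<bullet> w - c \<bullet> c' = (\<Sum>i\<in>UNIV. c $ i * (w $ i - c' $ i))"
    by (simp add: inner_vec_def sum_subtractf right_diff_distrib)
  also have "\<bar>\<dots>\<bar> \<le> (\<Sum>i\<in>(UNIV :: 'd set). real k * r)"
  proof (rule order_trans[OF sum_abs sum_mono])
    fix i
    show "\<bar>c $ i * (w $ i - c' $ i)\<bar> \<le> real k * r"
    proof (cases "i = z")
      case True
      then show ?thesis using W_z[OF assms(1)] r_pos by simp
    next
      case False
      then show ?thesis
        using cellD(3)[OF assms(2) False] W_nonneg[OF assms(1)] W_le[OF assms(1)]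
        by (simp add: abs_mult mult_mono)
    qed
  qed
  also have "\<dots> = 1 / 8" using dkr by simp
  finally show ?thesis .
qed

text \<open>
  The tangent functional of the paraboloid \<open>w $ z = h * (norm w)\<^sup>2\<close> over \<open>c\<close> separates the point
  of the cell of \<open>c\<close> from the points of the other cells.
\<close>

lemma convex_position_cells:
  assumes h: "0 < h" and w: "\<And>c. c \<in> W \<Longrightarrow> w c \<in> cell z r h c"
  shows "convex_position (w ` W)"
proof -
  let ?a = "\<lambda>c. axis z (1 / h) - 2 *\<^sub>R c"
  have sep: "?a c \<bullet> w c < ?a c \<bullet> w c'" if c: "c \<in> W" "c' \<in> W" "c \<noteq> c'" for c c'
  proof -
    have a: "?a c \<bullet> x = x $ z / h - 2 * (c \<bullet> x)" for x
      by (simp add: inner_diff_left inner_axis' )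
    have "w c $ z / h \<le> c \<bullet> c + r" "c' \<bullet> c' - r \<le> w c' $ z / h"
      using cellD(1,2)[OF w[OF c(1)]] cellD(1,2)[OF w[OF c(2)]] h by (simp_all add: field_simps)
    moreover have "\<bar>c \<bullet> w c - c \<bullet> c\<bar> \<le> 1 / 8" "\<bar>c \<bullet> w c' - c \<bullet> c'\<bar> \<le> 1 / 8"
      using inner_cell[OF c(1) w[OF c(1)]] inner_cell[OF c(1) w[OF c(2)]] by simp_all
    moreover have "1 \<le> c \<bullet> c + c' \<bullet> c' - 2 * (c \<bullet> c')"
      using separation[OF c] by (simp add: inner_diff_left inner_diff_right inner_commute)
    \<comment> \<open>The squared distance of the centres gives a gap of 1, against errors of
      \<open>2 * r\<close> from the heights and 1/2 from the inner products.\<close>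
    ultimately show ?thesis unfolding a using r_le(1) by linarith
  qed
  show "convex_position (w ` W)"
    unfolding convex_position_def
  proof (intro conjI ballI)
    show "finite (w ` W)" using finite_W by simp
    fix x assume "x \<in> w ` W"
    then obtain c where c: "c \<in> W" "x = w c" by auto
    have "convex hull (w ` W - {x}) \<subseteq> {y. ?a c \<bullet> y > ?a c \<bullet> x}"
      by (rule hull_minimal) (use sep c in \<open>auto simp: convex_halfspace_gt\<close>)
    then show "x \<notin> convex hull (w ` W - {x})" by auto
  qed
qed

text \<open>Integer centres whose cells share a horizontal position are closer than 1 in each
  coordinate. Shears keep horizontal positions, so this also compares cells of two different
  hyperplanes.\<close>

lemma cell_centre_unique:
  assumes c: "c \<in> W" "c' \<in> W" and w: "w \<in> cell z r h c" "w' \<in> cell z r h c'"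
    and eq: "\<And>i. i \<noteq> z \<Longrightarrow> w $ i = w' $ i"
  shows "c = c'"
proof (subst vec_eq_iff, intro allI)
  fix i
  show "c $ i = c' $ i"
  proof (cases "i = z")
    case False
    then have "\<bar>c $ i - c' $ i\<bar> < 1"
      using cellD(3)[OF w(1) False] cellD(3)[OF w(2) False] eq[OF False] r_le(1) by linarith
    then show ?thesis using Ints_eq_if_dist_less_1 W_Ints c by blast
  qed (use W_z c in auto)
qed

text \<open>If the cells of two grid hyperplanes meet over every centre, the integer coefficient
  differences \<open>\<delta>\<close> have a small tilt near every centre. The centres 0 and
  \<open>axis i 1\<close> then force every \<open>\<delta> i\<close> below 1 in absolute
  value.\<close>

lemma tilt_unique:
  fixes m m' :: "'d \<Rightarrow> nat"
  assumes n: "0 < n" and \<tau>: "\<tau> \<le> 1"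
    and meet: "\<And>c. c \<in> W \<Longrightarrow> shear z (\<lambda>i. m i / real n) ` cell z r (\<tau> / n) c \<inter>
      shear z (\<lambda>i. m' i / real n) ` cell z r (\<tau> / n) c \<noteq> {}"
  shows "m = m'"
proof -
  define \<delta> where "\<delta> i = real (m i) - real (m' i)" for i
  have small: "\<exists>w \<in> cell z r (\<tau> / n) c. \<bar>tilt z \<delta> w\<bar> \<le> 2 * r" if "c \<in> W" for c
  proof -
    obtain w w' where w: "w \<in> cell z r (\<tau> / n) c" "w' \<in> cell z r (\<tau> / n) c"
      and eq: "shear z (\<lambda>i. m i / real n) w = shear z (\<lambda>i. m' i / real n) w'"
      using meet[OF \<open>c \<in> W\<close>] by auto
    have "w $ i = w' $ i" if "i \<noteq> z" for i
      using arg_cong[OF eq, of "\<lambda>v. v $ i"] that by (simp add: shear_nth)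
    then have "tilt z (\<lambda>i. m' i / real n) w' = tilt z (\<lambda>i. m' i / real n) w"
      by (intro tilt_cong) simp
    then have "w' $ z - w $ z = tilt z (\<lambda>i. m i / real n) w - tilt z (\<lambda>i. m' i / real n) w"
      using arg_cong[OF eq, of "\<lambda>v. v $ z"] by (simp add: shear_nth)
    also have "\<dots> = tilt z (\<lambda>i. real (m i)) w / n - tilt z (\<lambda>i. real (m' i)) w / n"
      by (simp add: tilt_def add_divide_distrib sum_divide_distrib)
    also have "\<dots> = tilt z \<delta> w / n"
      by (simp add: tilt_def \<delta>_def left_diff_distrib sum_subtractf flip: diff_divide_distrib)
    finally have t: "tilt z \<delta> w = n * (w' $ z - w $ z)" using n by simp
    \<comment> \<open>Both heights lie in one interval of length
      \<open>2 * (\<tau> / n * r)\<close>; multiplying by \<open>n\<close> cancels the grid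
      scale.\<close>
    have "\<bar>w' $ z - w $ z\<bar> \<le> 2 * (\<tau> / n * r)"
      using cellD(1,2)[OF w(1)] cellD(1,2)[OF w(2)] unfolding right_diff_distrib distrib_left by linarith
    then have "n * \<bar>w' $ z - w $ z\<bar> \<le> n * (2 * (\<tau> / n * r))"
      by (rule mult_left_mono) simp
    also have "\<dots> = 2 * r * \<tau>" using n by simp
    finally have "\<bar>tilt z \<delta> w\<bar> \<le> 2 * r * \<tau>" unfolding t abs_mult by simp
    also have "\<dots> \<le> 2 * r * 1" using \<tau> r_pos by (intro mult_left_mono) auto
    finally show ?thesis using w(1) by auto
  qed
  define M where "M = Max (range (\<lambda>i. \<bar>\<delta> i\<bar>))"
  have M: "\<bar>\<delta> i\<bar> \<le> M" for i unfolding M_def by (rule Max_ge) auto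
  have M0: "0 \<le> M" using M[of z] by linarith
  \<comment> \<open>Moving from the common point to the centre itself costs at most
    \<open>M / 8\<close>, because \<open>CARD('d) * r\<close> is at most 1/8.\<close>
  have dev: "\<bar>\<delta> z + (\<Sum>i\<in>UNIV - {z}. \<delta> i * c $ i)\<bar> \<le> 2 * r + M / 8" if "c \<in> W" for c
  proof -
    obtain w where w: "w \<in> cell z r (\<tau> / n) c" "\<bar>tilt z \<delta> w\<bar> \<le> 2 * r"
      using small[OF \<open>c \<in> W\<close>] by blast
    have "\<bar>\<Sum>i\<in>UNIV - {z}. \<delta> i * (c $ i - w $ i)\<bar> \<le> (\<Sum>i\<in>UNIV - {z}. M * r)"
    proof (rule order_trans[OF sum_abs sum_mono])
      fix i assume "i \<in> UNIV - {z}"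
      then have "\<bar>c $ i - w $ i\<bar> \<le> r" using cellD(3)[OF w(1), of i] by (auto simp: abs_minus_commute)
      then show "\<bar>\<delta> i * (c $ i - w $ i)\<bar> \<le> M * r"
        unfolding abs_mult using M M0 by (intro mult_mono) auto
    qed
    also have "\<dots> \<le> (\<Sum>i\<in>(UNIV :: 'd set). M * r)"
      by (rule sum_mono2) (use M0 r_pos in auto)
    also have "\<dots> = M * (real CARD('d) * r)" by simp
    also have "\<dots> \<le> M * (1 / 8)" by (rule mult_left_mono[OF r_le(2) M0])
    finally have "\<bar>\<Sum>i\<in>UNIV - {z}. \<delta> i * (c $ i - w $ i)\<bar> \<le> M / 8" by simp
    moreover have "(\<Sum>i\<in>UNIV - {z}. \<delta> i * (c $ i - w $ i))
        = (\<Sum>i\<in>UNIV - {z}. \<delta> i * c $ i) - (\<Sum>i\<in>UNIV - {z}. \<delta> i * w $ i)"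
      by (simp add: right_diff_distrib sum_subtractf)
    ultimately show ?thesis using w(2) unfolding tilt_def by linarith
  qed
  have z: "\<bar>\<delta> z\<bar> \<le> 2 * r + M / 8" using dev[OF zero_W] by simp
  have "\<bar>\<delta> i\<bar> \<le> 4 * r + M / 4" for i
  proof (cases "i = z")
    case True
    then show ?thesis using z r_pos M0 by simp
  next
    case False
    have "(\<Sum>j\<in>UNIV - {z}. \<delta> j * axis i 1 $ j) = \<delta> i"
      using False by (simp add: axis_def if_distrib cong: if_cong)
    then show ?thesis using dev[OF axis_W[OF False]] z by simp
  qed
  \<comment> \<open>The maximum is bounded by a quarter of itself plus \<open>4 * r\<close>, so
    \<open>M\<close> is at most \<open>16 * r / 3\<close>, which is below 1.\<close>
  then have "M \<le> 4 * r + M / 4" unfolding M_def by (intro Max.boundedI) auto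
  then have "M < 1" using r_le(1) by simp
  have "m i = m' i" for i
  proof -
    have "real (m i) = real (m' i)"
      by (rule Ints_eq_if_dist_less_1) (use M[of i] \<open>M < 1\<close> in \<open>auto simp: \<delta>_def\<close>)
    then show ?thesis by simp
  qed
  then show ?thesis by blast
qed

section \<open>The slab, its volume, and an enclosing cube\<close>

definition height :: real where "height = real CARD('d) * (real k)\<^sup>2 + 1"

text \<open>\<open>height\<close> bounds \<open>c \<bullet> c + r\<close>, since the coordinates of
  centres are at most \<open>k\<close>. One box thus holds all cells, with volume proportional to
  \<open>h\<close>.\<close>

definition slab :: "real \<Rightarrow> (real ^ 'd) set"
  where "slab h = cbox (\<chi> i. if i = z then - h else - 1) (\<chi> i. if i = z then h * height else real k + 1)"

definition slab_volume :: real
  where "slab_volume = (height + 1) * (real k + 2) ^ (CARD('d) - 1)"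

text \<open>Half-width of a cube around every sheared slab with \<open>h\<close> at most 1:
  \<open>height + 1\<close> for the vertical coordinate and \<open>1 + CARD('d) * (k + 1)\<close>
  for a tilt with coefficients in \<open>[0, 1]\<close>.\<close>

definition extent :: real where "extent = height + 2 + real CARD('d) * (real k + 1)"

lemma height_ge_1: "1 \<le> height"
  by (simp add: height_def)

lemma slab_volume_ge_1: "1 \<le> slab_volume"
proof -
  have "1 * 1 \<le> slab_volume"
    unfolding slab_volume_def using height_ge_1 by (intro mult_mono one_le_power) auto
  then show ?thesis by simp
qed

lemma extent_ge_1: "1 \<le> extent"
proof -
  have "0 \<le> real CARD('d) * (real k + 1)" by simp
  then show ?thesis unfolding extent_def using height_ge_1 by linarith
qed

lemma cell_subset_slab:
  assumes "c \<in> W" "0 < h"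
  shows "cell z r h c \<subseteq> slab h"
proof
  fix w assume w: "w \<in> cell z r h c"
  have "c \<bullet> c = (\<Sum>i\<in>UNIV. (c $ i)\<^sup>2)" by (simp add: inner_vec_def power2_eq_square)
  also have "\<dots> \<le> (\<Sum>i\<in>(UNIV :: 'd set). (real k)\<^sup>2)"
    by (intro sum_mono power_mono W_le W_nonneg assms)
  finally have "c \<bullet> c + r \<le> height" using r_le(1) by (simp add: height_def)
  then have "h * (c \<bullet> c + r) \<le> h * height"
    by (rule mult_left_mono) (use assms in simp)
  then have "w $ z \<le> h * height"
    using cellD(2)[OF w] by linarith
  moreover have "h * (-1) \<le> h * (c \<bullet> c - r)"
  proof (rule mult_left_mono)
    show "-1 \<le> c \<bullet> c - r" using inner_ge_zero[of c] r_le(1) by linarith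
  qed (use assms in simp)
  moreover have "-1 \<le> w $ i \<and> w $ i \<le> real k + 1" if "i \<noteq> z" for i
    using cellD(3)[OF w that] W_nonneg[OF assms(1), of i] W_le[OF assms(1), of i] r_le(1) by linarith
  ultimately have "(if i = z then - h else - 1) \<le> w $ i \<and> w $ i \<le> (if i = z then h * height else real k + 1)" for i
    using cellD(1)[OF w] by (cases "i = z") auto
  then show "w \<in> slab h"
    by (simp add: slab_def mem_box_cart)
qed

lemma emeasure_slab:
  assumes "0 < h"
  shows "emeasure lborel (slab h) = ennreal (h * slab_volume)"
proof -
  have "emeasure lborel (slab h) = ennreal (\<Prod>i\<in>(UNIV :: 'd set). if i = z then h * (height + 1) else real k + 2)"
    unfolding slab_def
  proof (subst emeasure_lborel_cbox_cart)
    have "0 \<le> h * height" using assms height_ge_1 by simp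
    then show "(\<chi> i. if i = z then - h else - 1) $ i \<le> (\<chi> i. if i = z then h * height else real k + 1) $ i" for i
      using assms by simp
  qed (auto simp: distrib_left intro!: arg_cong[of _ _ ennreal] prod.cong)
  then show ?thesis by (simp add: prod_if_eq_const slab_volume_def mult.assoc)
qed

lemma shear_slab_subset:
  assumes h: "0 < h" "h \<le> 1" and t: "\<And>i. 0 \<le> t i" "\<And>i. t i \<le> 1"
  shows "shear z t ` slab h \<subseteq> cbox (\<chi> i. - extent) (\<chi> i. extent)"
proof clarify
  fix w assume w: "w \<in> slab h"
  have wi: "(if i = z then - h else - 1) \<le> w $ i \<and> w $ i \<le> (if i = z then h * height else real k + 1)" for i
    using w by (simp add: slab_def mem_box_cart)
  have wk: "\<bar>w $ i\<bar> \<le> real k + 1" if "i \<noteq> z" for i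
    using wi[of i] that by (simp add: abs_le_iff)
  have "h * height \<le> 1 * height" using h height_ge_1 by (intro mult_right_mono) auto
  moreover have "- h \<le> w $ z" "w $ z \<le> h * height" using wi[of z] by simp_all
  ultimately have wz: "\<bar>w $ z\<bar> \<le> height + 1"
    using h height_ge_1 by linarith
  have "\<bar>\<Sum>i\<in>UNIV - {z}. t i * w $ i\<bar> \<le> (\<Sum>i\<in>UNIV - {z}. real k + 1)"
  proof (rule order_trans[OF sum_abs sum_mono])
    fix i assume "i \<in> UNIV - {z}"
    then have "\<bar>t i\<bar> * \<bar>w $ i\<bar> \<le> 1 * (real k + 1)" using wk t[of i] by (intro mult_mono) auto
    then show "\<bar>t i * w $ i\<bar> \<le> real k + 1" by (simp add: abs_mult)
  qed
  also have "\<dots> \<le> (\<Sum>i\<in>(UNIV :: 'd set). real k + 1)"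
    by (rule sum_mono2) auto
  finally have "\<bar>tilt z t w\<bar> \<le> 1 + real CARD('d) * (real k + 1)"
    using t[of z] by (simp add: tilt_def)
  then have "\<bar>w $ z + tilt z t w\<bar> \<le> extent"
    using wz by (simp add: extent_def)
  moreover have "real k + 1 \<le> extent"
  proof -
    have "1 * (real k + 1) \<le> real CARD('d) * (real k + 1)" by (intro mult_right_mono) (auto simp: Suc_le_eq)
    then have "real k + 1 \<le> real CARD('d) * (real k + 1)" by (simp only: mult_1)
    then have "0 + (real k + 1) \<le> (height + 2) + real CARD('d) * (real k + 1)"
      by (rule add_mono[rotated]) (use height_ge_1 in simp)
    then show ?thesis unfolding extent_def by (simp only: add_0)
  qed
  ultimately have "\<bar>shear z t w $ i\<bar> \<le> extent" for i
    using wk[of i] by (auto simp: shear_nth)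
  then show "shear z t w \<in> cbox (\<chi> i. - extent) (\<chi> i. extent)"
    by (simp add: mem_box_cart abs_le_iff minus_le_iff)
qed

end

section \<open>Counting holes in the sample\<close>

text \<open>Outside a null set, each event containing \<open>X\<close> supplies its own hole, by
  \<open>inj\<close>. Linearity of the integral then handles the overlapping events.\<close>

lemma expected_holes_ge_sum_emeasure:
  fixes K :: "'a::euclidean_space set"
  defines "M \<equiv> uniform_measure lborel K"
  assumes K: "K \<in> sets borel" "emeasure lborel K = 1"
    and A: "finite A" "\<And>a. a \<in> A \<Longrightarrow> E a \<in> sets (\<Pi>\<^sub>M i\<in>{..<n}. M)"
    and hole: "\<And>a X. a \<in> A \<Longrightarrow> X \<in> E a \<Longrightarrow> inj_on X {..<n} \<Longrightarrow> general_position (X ` {..<n}) \<Longrightarrow>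
      is_hole k (X ` {..<n}) (T a X)"
    and inj: "\<And>X. inj_on X {..<n} \<Longrightarrow> inj_on (\<lambda>a. T a X) {a \<in> A. X \<in> E a}"
  shows "(\<Sum>a\<in>A. emeasure (\<Pi>\<^sub>M i\<in>{..<n}. M) (E a)) \<le> expected_holes K k n"
proof -
  let ?P = "\<Pi>\<^sub>M i\<in>{..<n}. M"
  interpret prob_space M
    unfolding M_def by (rule prob_space_uniform_measure) (use K in auto)
  have "AE X in ?P. inj_on X {..<n} \<and> general_position (X ` {..<n})"
  proof (rule AE_general_position)
    show "sigma_finite_measure M" by unfold_locales
    show "sets M = sets borel" by (simp add: M_def)
    show "emeasure M A = 0" if "A \<in> sets borel" "emeasure lborel A = 0" for A
      unfolding M_def using that K emeasure_mono[of "K \<inter> A" A lborel]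
      by (subst emeasure_uniform_measure) auto
  qed
  then have "AE X in ?P. (\<Sum>a\<in>A. indicator (E a) X) \<le> (of_nat (num_holes k (X ` {..<n})) :: ennreal)"
  proof eventually_elim
    fix X :: "nat \<Rightarrow> 'a" assume X: "inj_on X {..<n} \<and> general_position (X ` {..<n})"
    have "{T. is_hole k (X ` {..<n}) T} \<subseteq> Pow (X ` {..<n})" by (auto simp: is_hole_def)
    then have "card {a \<in> A. X \<in> E a} \<le> num_holes k (X ` {..<n})"
      unfolding num_holes_def using hole inj X
      by (intro card_inj_on_le[of "\<lambda>a. T a X"]) (auto intro: finite_subset)
    moreover have "(\<Sum>a\<in>A. indicator (E a) X :: ennreal) = of_nat (card {a \<in> A. X \<in> E a})"
      using A(1) by (simp add: indicator_def sum.If_cases Int_def)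
    ultimately show "(\<Sum>a\<in>A. indicator (E a) X) \<le> (of_nat (num_holes k (X ` {..<n})) :: ennreal)"
      by simp
  qed
  then have "(\<integral>\<^sup>+X. (\<Sum>a\<in>A. indicator (E a) X) \<partial>?P) \<le> (\<integral>\<^sup>+X. of_nat (num_holes k (X ` {..<n})) \<partial>?P)"
    by (rule nn_integral_mono_AE)
  moreover have "(\<integral>\<^sup>+X. (\<Sum>a\<in>A. indicator (E a) X) \<partial>?P) = (\<Sum>a\<in>A. emeasure ?P (E a))"
    using A(2) by (subst nn_integral_sum) auto
  ultimately show ?thesis
    by (simp add: expected_holes_def M_def)
qed

text \<open>The count is a falling factorial whose \<open>k\<close> factors are each at least
  \<open>n / 2\<close>.\<close>

lemma card_inj_PiE_ge:
  assumes "finite W" "card W = k" "2 * k \<le> n"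
  shows "(real n / 2) ^ k \<le> real (card {s \<in> W \<rightarrow>\<^sub>E {..<n}. inj_on s W})"
proof -
  have "card {s \<in> W \<rightarrow>\<^sub>E {..<n}. inj_on s W} = (\<Prod>i<k. n - i)"
    using card_inj_on_subset_funcset[of W "{..<n}" W] assms by (simp add: atLeast0LessThan)
  moreover have "(\<Prod>i<k. real n / 2) \<le> (\<Prod>i<k. real (n - i))"
    using assms(3) by (intro prod_mono) (auto simp: of_nat_diff)
  ultimately show ?thesis by simp
qed

section \<open>Hole events in a fixed convex body\<close>

context hole_pattern
begin

context
  fixes n :: nat and h \<tau> D :: real and K :: "(real ^ 'd) set" and v :: "real ^ 'd" and F
  assumes n_pos: "0 < n" and \<tau>: "\<tau> = 1 / (2 * slab_volume)" and h: "h = \<tau> / n"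
    and lin_F: "linear F" and bij_F: "bij F" and D: "volume_scaling (\<lambda>x. v + F x) D"
    and sub_K: "(\<lambda>x. v + F x) ` cbox (\<chi> i. - extent) (\<chi> i. extent) \<subseteq> K"
    and K_borel: "K \<in> sets borel" and K_vol: "emeasure lborel K = 1"
begin

text \<open>Grid coefficients with step \<open>1 / n\<close>, the same order as the slab thickness
  \<open>h\<close>, followed by the affine map into \<open>K\<close>.\<close>

definition place :: "('d \<Rightarrow> nat) \<Rightarrow> real ^ 'd \<Rightarrow> real ^ 'd"
  where "place m w = v + F (shear z (\<lambda>i. real (m i) / real n) w)"

text \<open>\<open>s\<close> names the sample point prescribed for each centre; every other point
  has to avoid the slab. All conditions concern single coordinates and fixed sets, so the event is a
  product and its probability factors.\<close>

definition hole_event :: "('d \<Rightarrow> nat) \<Rightarrow> (real ^ 'd \<Rightarrow> nat) \<Rightarrow> (nat \<Rightarrow> real ^ 'd) set"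
  where "hole_event m s = (\<Pi>\<^sub>E i\<in>{..<n}.
    if i \<in> s ` W then place m ` cell z r h (inv_into W s i) else UNIV - place m ` slab h)"

lemma tau_bounds: "0 < \<tau>" "\<tau> \<le> 1" "h > 0" "h \<le> 1"
proof -
  show \<tau>': "0 < \<tau>" "\<tau> \<le> 1" using slab_volume_ge_1 by (simp_all add: \<tau>)
  show "h > 0" using \<tau>' n_pos by (simp add: h)
  have "\<tau> \<le> real n" using \<tau>'(2) n_pos by linarith
  then show "h \<le> 1" using n_pos by (simp add: h)
qed

lemma place_affine:
  obtains c G where "linear G" "bij G" "place m = (\<lambda>w. c + G w)"
proof -
  obtain c G where G: "linear G" "bij G" "shear z (\<lambda>i. real (m i) / real n) = (\<lambda>w. c + G w)"
    by (rule shear_affine)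
  have "place m = (\<lambda>w. (v + F c) + (F \<circ> G) w)"
    by (simp add: fun_eq_iff place_def G(3) linear_add[OF lin_F])
  with linear_compose[OF G(1) lin_F] bij_comp[OF G(2) bij_F] show thesis
    by (rule that)
qed

lemma place_eq_iff: "place m w = place m' w' \<longleftrightarrow>
    shear z (\<lambda>i. real (m i) / real n) w = shear z (\<lambda>i. real (m' i) / real n) w'"
  by (simp add: place_def inj_eq[OF bij_is_inj[OF bij_F]])

lemma volume_scaling_place: "volume_scaling (place m) D"
  using volume_scaling_comp[OF D volume_scaling_shear[of z "\<lambda>i. real (m i) / real n"]]
  by (simp add: place_def[abs_def] comp_def)

lemma convex_place: "convex C \<Longrightarrow> convex (place m ` C)"
proof -
  assume C: "convex C"
  obtain c G where G: "linear G" "bij G" "place m = (\<lambda>w. c + G w)"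
    by (rule place_affine)
  have "convex ((+) c ` G ` C)"
    using C G(1) by (intro convex_translation convex_linear_image)
  then show ?thesis by (simp add: G(3) image_image)
qed

lemma hole_event_cell:
  assumes s: "s \<in> W \<rightarrow>\<^sub>E {..<n}" "inj_on s W" and X: "X \<in> hole_event m s" and c: "c \<in> W"
  shows "X (s c) \<in> place m ` cell z r h c"
proof -
  have "s c \<in> {..<n}" using s c by auto
  then have "X (s c) \<in> (if s c \<in> s ` W then place m ` cell z r h (inv_into W s (s c)) else UNIV - place m ` slab h)"
    using X unfolding hole_event_def by (rule PiE_mem[rotated])
  then show ?thesis using s c by simp
qed

lemma hole_event_slab:
  assumes "X \<in> hole_event m s" "i < n" "X i \<in> place m ` slab h"
  shows "i \<in> s ` W"
proof (rule ccontr)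
  assume "i \<notin> s ` W"
  have "X i \<in> (if i \<in> s ` W then place m ` cell z r h (inv_into W s i) else UNIV - place m ` slab h)"
    using assms(1) unfolding hole_event_def by (rule PiE_mem) (use assms(2) in simp)
  then show False using \<open>i \<notin> s ` W\<close> assms(3) by simp
qed

text \<open>The placed slab is the convex set for \<open>is_hole_in_convex_set\<close>: it contains
  the chosen points and no others of the sample.\<close>

lemma hole_event_is_hole:
  assumes s: "s \<in> W \<rightarrow>\<^sub>E {..<n}" "inj_on s W" and X: "X \<in> hole_event m s"
    and gp: "inj_on X {..<n}" "general_position (X ` {..<n})"
  shows "is_hole k (X ` {..<n}) (X ` s ` W)"
proof (rule is_hole_in_convex_set[OF gp(2)])
  have sW: "s ` W \<subseteq> {..<n}" using s by auto
  then show "X ` s ` W \<subseteq> X ` {..<n}" by blast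
  have "inj_on X (s ` W)" using gp(1) sW by (rule inj_on_subset)
  then show "card (X ` s ` W) = k" by (simp only: card_image s(2) card_W)
  \<comment> \<open>Convex position is checked in the model cells and then carried over by the
    affine map \<open>place m\<close>.\<close>
  have "\<forall>c\<in>W. \<exists>w. w \<in> cell z r h c \<and> X (s c) = place m w"
    using hole_event_cell[OF s X] by blast
  from bchoice[OF this] obtain w where
    w': "\<forall>c\<in>W. w c \<in> cell z r h c \<and> X (s c) = place m (w c)" ..
  then have w: "\<And>c. c \<in> W \<Longrightarrow> w c \<in> cell z r h c" by blast
  obtain c G where G: "linear G" "bij G" "place m = (\<lambda>w. c + G w)"
    by (rule place_affine)
  have "X ` s ` W = place m ` w ` W"
    unfolding image_image by (rule image_cong) (use w' in simp_all)
  moreover have "convex_position ((\<lambda>x. c + G x) ` w ` W)"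
    by (intro convex_position_affine_image G bij_is_inj convex_position_cells[OF tau_bounds(3) w])
  ultimately show "convex_position (X ` s ` W)" by (simp only: G(3))
  show "convex (place m ` slab h)"
    by (rule convex_place) (simp add: slab_def convex_box)
  show "X ` s ` W \<subseteq> place m ` slab h"
  proof clarify
    fix c assume "c \<in> W"
    then show "X (s c) \<in> place m ` slab h"
      using hole_event_cell[OF s X] cell_subset_slab[OF _ tau_bounds(3)] by blast
  qed
  show "place m ` slab h \<inter> X ` {..<n} \<subseteq> X ` s ` W"
  proof (rule subsetI)
    fix x assume x: "x \<in> place m ` slab h \<inter> X ` {..<n}"
    then obtain i where "i < n" "x = X i" by auto
    then show "x \<in> X ` s ` W" using x by (auto intro!: imageI hole_event_slab[OF X])
  qed
qed

text \<open>First \<open>s\<close>, then \<open>m\<close>: shears keep the horizontal coordinates,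
  so each sample point reveals its centre whichever hyperplane is used. With \<open>s = s'\<close>,
  the two families of cells meet over every centre and \<open>tilt_unique\<close> applies.\<close>

lemma hole_event_unique:
  assumes s: "s \<in> W \<rightarrow>\<^sub>E {..<n}" "inj_on s W" "X \<in> hole_event m s"
    and s': "s' \<in> W \<rightarrow>\<^sub>E {..<n}" "inj_on s' W" "X \<in> hole_event m' s'"
    and X: "inj_on X {..<n}" and eq: "X ` s ` W = X ` s' ` W"
  shows "m = m' \<and> s = s'"
proof
  have "s ` W = s' ` W"
    using eq inj_on_image_eq_iff[OF X, of "s ` W" "s' ` W"] s(1) s'(1) by blast
  have "s c = s' c" if c: "c \<in> W" for c
  proof -
    obtain c' where c': "c' \<in> W" "s c = s' c'"
      using \<open>s ` W = s' ` W\<close> c by blast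
    obtain w where w: "w \<in> cell z r h c" "X (s c) = place m w"
      using hole_event_cell[OF s c] by auto
    obtain w' where w': "w' \<in> cell z r h c'" "X (s c) = place m' w'"
      using hole_event_cell[OF s' c'(1)] c'(2) by auto
    have eq: "shear z (\<lambda>i. real (m i) / real n) w = shear z (\<lambda>i. real (m' i) / real n) w'"
      using w(2) w'(2) place_eq_iff by simp
    have "w $ i = w' $ i" if "i \<noteq> z" for i
      using arg_cong[OF eq, of "\<lambda>v. v $ i"] that by (simp add: shear_nth)
    then have "c = c'" using cell_centre_unique[OF c c'(1) w(1) w'(1)] by simp
    then show ?thesis using c' by simp
  qed
  then show "s = s'" by (intro PiE_ext[OF s(1) s'(1)])
  show "m = m'"
  proof (rule tilt_unique[OF n_pos tau_bounds(2)])
    fix c assume c: "c \<in> W"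
    obtain w where w: "w \<in> cell z r h c" "X (s c) = place m w"
      using hole_event_cell[OF s c] by auto
    obtain w' where w': "w' \<in> cell z r h c" "X (s c) = place m' w'"
      using hole_event_cell[OF s' c] \<open>s = s'\<close> by auto
    have eq: "shear z (\<lambda>i. real (m i) / real n) w = shear z (\<lambda>i. real (m' i) / real n) w'"
      using w(2) w'(2) place_eq_iff by simp
    then show "shear z (\<lambda>i. real (m i) / real n) ` cell z r (\<tau> / n) c \<inter>
        shear z (\<lambda>i. real (m' i) / real n) ` cell z r (\<tau> / n) c \<noteq> {}"
      using w(1) w'(1) unfolding h by blast
  qed
qed

text \<open>For the upper bound, the image of a cube of side at least 1 fits into \<open>K\<close>,
  which has volume 1.\<close>

lemma D_bounds: "0 < D" "D \<le> 1"
proof -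
  show D0: "0 < D" using D by (simp add: volume_scaling_def)
  let ?B = "cbox (\<chi> i. - extent) (\<chi> i. extent) :: (real ^ 'd) set"
  have "ennreal D * emeasure lborel ?B = emeasure lborel ((\<lambda>x. v + F x) ` ?B)"
    using D by (simp add: volume_scaling_def)
  also have "\<dots> \<le> 1"
    using emeasure_mono[OF sub_K, of lborel] K_borel K_vol by simp
  also have "emeasure lborel ?B = ennreal ((2 * extent) ^ CARD('d))"
    by (subst emeasure_lborel_cbox_cart) (use extent_ge_1 in auto)
  also have "ennreal D * \<dots> = ennreal (D * (2 * extent) ^ CARD('d))"
    by (rule ennreal_mult'[symmetric]) (use D0 in simp)
  finally have "D * (2 * extent) ^ CARD('d) \<le> 1" by simp
  moreover have "D * 1 \<le> D * (2 * extent) ^ CARD('d)"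
    using D0 extent_ge_1 by (intro mult_left_mono one_le_power) auto
  ultimately show "D \<le> 1" by simp
qed

abbreviation "unif \<equiv> uniform_measure lborel K"

lemma place_slab_subset:
  assumes "m \<in> UNIV \<rightarrow>\<^sub>E {..<n}"
  shows "place m ` slab h \<subseteq> K"
proof -
  have "m i < n" for i using assms by auto
  then have "shear z (\<lambda>i. real (m i) / real n) ` slab h \<subseteq> cbox (\<chi> i. - extent) (\<chi> i. extent)"
    using tau_bounds(3,4) n_pos by (intro shear_slab_subset) (auto simp: less_imp_le)
  then have "(\<lambda>x. v + F x) ` (shear z (\<lambda>i. real (m i) / real n) ` slab h) \<subseteq> K"
    using sub_K by blast
  then show ?thesis by (simp add: place_def[abs_def] image_image)
qed

lemma unif_place:
  assumes "m \<in> UNIV \<rightarrow>\<^sub>E {..<n}" and B: "B \<in> sets borel" "B \<subseteq> slab h" "emeasure lborel B = ennreal b" "0 \<le> b"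
  shows "place m ` B \<in> sets borel" "emeasure unif (place m ` B) = ennreal (D * b)"
proof -
  show pB: "place m ` B \<in> sets borel"
    using volume_scaling_place B(1) unfolding volume_scaling_def by blast
  have "K \<inter> place m ` B = place m ` B" using place_slab_subset[OF assms(1)] B(2) by blast
  then have "emeasure unif (place m ` B) = emeasure lborel (place m ` B)"
    using pB K_borel K_vol by (subst emeasure_uniform_measure) (auto simp: divide_ennreal_def)
  also have "\<dots> = ennreal D * ennreal b"
    using volume_scaling_place B unfolding volume_scaling_def by metis
  also have "\<dots> = ennreal (D * b)" by (rule ennreal_mult'[symmetric]) (use D_bounds in simp)
  finally show "emeasure unif (place m ` B) = ennreal (D * b)" .
qed

text \<open>Independence gives \<open>k\<close> factors of order \<open>1 / n\<close> for the cells
  and \<open>n - k\<close> factors of at least \<open>1 - 1 / (2 * n)\<close> for avoiding the slab.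
  The parameter \<open>q\<close> allows a bound uniform in \<open>K\<close>.\<close>

lemma prob_hole_event_ge:
  assumes m: "m \<in> UNIV \<rightarrow>\<^sub>E {..<n}" and s: "s \<in> W \<rightarrow>\<^sub>E {..<n}" "inj_on s W"
    and q: "0 \<le> q" "q \<le> D * (\<tau> * (2 * r) ^ CARD('d))"
  shows "hole_event m s \<in> sets (\<Pi>\<^sub>M i\<in>{..<n}. unif)"
    and "ennreal ((q / n) ^ k / 2) \<le> emeasure (\<Pi>\<^sub>M i\<in>{..<n}. unif) (hole_event m s)"
proof -
  interpret M: prob_space unif
    by (rule prob_space_uniform_measure) (use K_borel K_vol in auto)
  interpret product_sigma_finite "\<lambda>_::nat. unif" ..
  let ?A = "\<lambda>i. if i \<in> s ` W then place m ` cell z r h (inv_into W s i) else UNIV - place m ` slab h"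
  have slabB: "slab h \<in> sets borel" by (simp add: slab_def)
  have cell: "place m ` cell z r h c \<in> sets borel"
    "emeasure unif (place m ` cell z r h c) = ennreal (D * (h * (2 * r) ^ CARD('d)))" if "c \<in> W" for c
  proof -
    have *: "cell z r h c \<in> sets borel" by (simp add: cell_def)
    show "place m ` cell z r h c \<in> sets borel"
      "emeasure unif (place m ` cell z r h c) = ennreal (D * (h * (2 * r) ^ CARD('d)))"
      using unif_place[OF m * cell_subset_slab[OF that tau_bounds(3)] emeasure_cell[OF r_pos tau_bounds(3)]]
        tau_bounds(3) r_pos by simp_all
  qed
  have slab: "place m ` slab h \<in> sets borel"
    "emeasure unif (place m ` slab h) = ennreal (D * (h * slab_volume))"
    using unif_place[OF m slabB subset_refl emeasure_slab[OF tau_bounds(3)]]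
      tau_bounds(3) slab_volume_ge_1 by simp_all
  have "D * (h * slab_volume) \<le> 1 * (h * slab_volume)"
    using D_bounds tau_bounds(3) slab_volume_ge_1 by (intro mult_right_mono) auto
  \<comment> \<open>The choice of \<open>\<tau>\<close> enters here: a sample point hits the slab
    with probability at most \<open>1 / (2 * n)\<close>.\<close>
  also have "\<dots> = 1 / (2 * n)" using slab_volume_ge_1 by (simp add: h \<tau>)
  finally have small: "D * (h * slab_volume) \<le> 1 / (2 * n)" .
  have "emeasure unif (UNIV - place m ` slab h) = 1 - emeasure unif (place m ` slab h)"
    using emeasure_compl[of "place m ` slab h" unif] slab(1) M.emeasure_space_1 by (simp add: slab(2))
  also have "\<dots> = ennreal (1 - D * (h * slab_volume))"
    unfolding slab(2) using D_bounds tau_bounds(3) slab_volume_ge_1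
    by (subst ennreal_minus[symmetric]) auto
  finally have comp: "emeasure unif (UNIV - place m ` slab h) = ennreal (1 - D * (h * slab_volume))" .
  have sW: "s ` W \<subseteq> {..<n}" using s by auto
  have Ai: "?A i \<in> sets unif" for i
    using cell slab by (auto simp: inv_into_into)
  then show "hole_event m s \<in> sets (\<Pi>\<^sub>M i\<in>{..<n}. unif)"
    unfolding hole_event_def by (intro sets_PiM_I_finite) auto
  have "emeasure (\<Pi>\<^sub>M i\<in>{..<n}. unif) (hole_event m s) = (\<Prod>i<n. emeasure unif (?A i))"
    unfolding hole_event_def using Ai by (intro emeasure_PiM) auto
  also have "\<dots> = (\<Prod>i\<in>{..<n} - s ` W. emeasure unif (?A i)) * (\<Prod>i\<in>s ` W. emeasure unif (?A i))"
    by (rule prod.subset_diff[OF sW]) simp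
  also have "(\<Prod>i\<in>s ` W. emeasure unif (?A i)) = (\<Prod>i\<in>s ` W. ennreal (D * (h * (2 * r) ^ CARD('d))))"
    by (intro prod.cong refl) (simp add: cell inv_into_into)
  also have "\<dots> = ennreal ((D * (h * (2 * r) ^ CARD('d))) ^ k)"
    using s(2) D_bounds tau_bounds(3) r_pos by (simp add: card_image card_W ennreal_power)
  also have "(\<Prod>i\<in>{..<n} - s ` W. emeasure unif (?A i)) = (\<Prod>i\<in>{..<n} - s ` W. ennreal (1 - D * (h * slab_volume)))"
    by (intro prod.cong refl) (simp add: comp)
  also have "\<dots> = ennreal ((1 - D * (h * slab_volume)) ^ card ({..<n} - s ` W))"
  proof -
    have "1 / (2 * real n) \<le> 1" using n_pos by simp
    then show ?thesis using small by (simp add: ennreal_power)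
  qed
  finally have P: "emeasure (\<Pi>\<^sub>M i\<in>{..<n}. unif) (hole_event m s)
    = ennreal ((1 - D * (h * slab_volume)) ^ card ({..<n} - s ` W)) * ennreal ((D * (h * (2 * r) ^ CARD('d))) ^ k)" .
  have "1 / 2 \<le> (1 - D * (h * slab_volume)) ^ card ({..<n} - s ` W)"
  proof -
    have n1: "0 \<le> 1 - 1 / (2 * real n)" using n_pos by simp
    \<comment> \<open>Bernoulli's inequality for the exponent \<open>n\<close>; the actual exponent
      is at most \<open>n\<close> and the base at most 1, so the power only grows.\<close>
    have "1 / 2 = 1 + real n * (- (1 / (2 * real n)))" using n_pos by simp
    also have "\<dots> \<le> (1 + (- (1 / (2 * real n)))) ^ n"
      by (rule Bernoulli_inequality) (use n1 in simp)
    also have "\<dots> \<le> (1 + (- (1 / (2 * real n)))) ^ card ({..<n} - s ` W)"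
      using n1 card_mono[of "{..<n}" "{..<n} - s ` W"] by (intro power_decreasing) auto
    also have "\<dots> \<le> (1 - D * (h * slab_volume)) ^ card ({..<n} - s ` W)"
      using small n1 by (intro power_mono) auto
    finally show ?thesis .
  qed
  moreover have "(q / n) ^ k \<le> (D * (h * (2 * r) ^ CARD('d))) ^ k"
  proof (rule power_mono)
    have "q / n \<le> D * (\<tau> * (2 * r) ^ CARD('d)) / n" using q n_pos by (simp add: divide_right_mono)
    then show "q / n \<le> D * (h * (2 * r) ^ CARD('d))" by (simp add: h)
  qed (use q in simp)
  ultimately have "1 / 2 * (q / n) ^ k \<le> (1 - D * (h * slab_volume)) ^ card ({..<n} - s ` W) *
      (D * (h * (2 * r) ^ CARD('d))) ^ k"
    using q by (intro mult_mono) auto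
  then show "ennreal ((q / n) ^ k / 2) \<le> emeasure (\<Pi>\<^sub>M i\<in>{..<n}. unif) (hole_event m s)"
    unfolding P using D_bounds tau_bounds(3) r_pos
    by (subst ennreal_mult''[symmetric]) (auto intro!: ennreal_leI)
qed

text \<open>There are \<open>n ^ CARD('d)\<close> grid hyperplanes and at least
  \<open>(n / 2) ^ k\<close> injective index choices; the latter cancel the factor
  \<open>n ^ k\<close> lost in each probability.\<close>

lemma expected_holes_ge:
  assumes q: "0 \<le> q" "q \<le> D * (\<tau> * (2 * r) ^ CARD('d))" and n: "2 * k \<le> n"
  shows "ennreal ((q / 2) ^ k / 2 * real n ^ CARD('d)) \<le> expected_holes K k n"
proof -
  let ?S = "{s \<in> W \<rightarrow>\<^sub>E {..<n}. inj_on s W}"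
  let ?A = "((UNIV :: 'd set) \<rightarrow>\<^sub>E {..<n}) \<times> ?S"
  let ?P = "\<Pi>\<^sub>M i\<in>{..<n}. unif"
  have fin: "finite ?A"
    by (intro finite_cartesian_product finite_PiE finite_subset[OF _ finite_PiE[OF finite_W, of "\<lambda>_. {..<n}"]]) auto
  have "card ((UNIV :: 'd set) \<rightarrow>\<^sub>E {..<n}) = n ^ CARD('d)"
    by (simp add: card_PiE)
  then have card: "real (card ?A) = real n ^ CARD('d) * real (card ?S)"
    by (simp add: card_cartesian_product)
  have "(q / 2) ^ k / 2 * real n ^ CARD('d) = real n ^ CARD('d) * (real n / 2) ^ k * ((q / n) ^ k / 2)"
    using n_pos by (simp add: power_divide field_simps)
  also have "\<dots> \<le> real (card ?A) * ((q / n) ^ k / 2)"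
    unfolding card using card_inj_PiE_ge[OF finite_W card_W n] q
    by (intro mult_right_mono mult_left_mono) auto
  finally have "ennreal ((q / 2) ^ k / 2 * real n ^ CARD('d)) \<le> ennreal (real (card ?A) * ((q / n) ^ k / 2))"
    by (rule ennreal_leI)
  also have "\<dots> = (\<Sum>a\<in>?A. ennreal ((q / n) ^ k / 2))"
    unfolding sum_constant ennreal_of_nat_eq_real_of_nat by (rule ennreal_mult') simp
  also have "\<dots> \<le> (\<Sum>a\<in>?A. emeasure ?P (hole_event (fst a) (snd a)))"
    by (intro sum_mono prob_hole_event_ge(2)[OF _ _ _ q]) auto
  also have "\<dots> \<le> expected_holes K k n"
  proof (rule expected_holes_ge_sum_emeasure[OF K_borel K_vol fin, where T = "\<lambda>a X. X ` snd a ` W"])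
    show "hole_event (fst a) (snd a) \<in> sets ?P" if "a \<in> ?A" for a
      by (rule prob_hole_event_ge(1)[OF _ _ _ q]) (use that in auto)
    show "is_hole k (X ` {..<n}) (X ` snd a ` W)"
      if "a \<in> ?A" "X \<in> hole_event (fst a) (snd a)" "inj_on X {..<n}" "general_position (X ` {..<n})" for a X
      using that by (intro hole_event_is_hole[of _ _ "fst a"]) auto
    show "inj_on (\<lambda>a. X ` snd a ` W) {a \<in> ?A. X \<in> hole_event (fst a) (snd a)}" if "inj_on X {..<n}" for X
      by (rule inj_onI) (use hole_event_unique[OF _ _ _ _ _ _ that] in \<open>force simp: prod_eq_iff\<close>)
  qed
  finally show ?thesis .
qed

end

end

theorem theorem1:
  fixes k :: nat
  assumes "CARD('d::finite) \<ge> 2" and "k \<ge> CARD('d) + 1"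
  shows "\<exists>C>0. \<exists>n0::nat. \<forall>n\<ge>n0. \<forall>K :: (real ^ 'd) set.
    convex_body K \<and> emeasure lborel K = 1 \<longrightarrow>
      expected_holes K k n \<ge> ennreal (C * real n ^ CARD('d))"
proof -
  \<comment> \<open>Any coordinate serves as the vertical axis.\<close>
  fix z :: 'd
  have k: "k \<ge> CARD('d)" "0 < k" using assms by auto
  have "\<exists>W. hole_pattern z W k (1 / (8 * real CARD('d) * real k))"
    by (rule exists_integer_centres[OF assms(1) k(1), of z], intro exI, unfold_locales) (use k in auto)
  then obtain W where W: "hole_pattern z W k (1 / (8 * real CARD('d) * real k))" ..
  interpret hole_pattern z W k "1 / (8 * real CARD('d) * real k)" by (rule W)
  define r where "r = 1 / (8 * real CARD('d) * real k)"
  define \<tau> where "\<tau> = 1 / (2 * slab_volume)"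
  \<comment> \<open>The lower bound on \<open>D\<close> from \<open>inscribed_parallelotope\<close>
    with \<open>Q = extent\<close>. It depends only on the dimension and \<open>k\<close>, which
    makes \<open>q\<close> independent of \<open>K\<close>.\<close>
  define \<delta> where "\<delta> = (1 / (4 * real CARD('d) * extent)) ^ CARD('d)"
  define q where "q = \<delta> * (\<tau> * (2 * r) ^ CARD('d))"
  have \<tau>: "\<tau> > 0" using slab_volume_ge_1 by (simp add: \<tau>_def)
  have \<delta>: "\<delta> > 0" using extent_ge_1 by (simp add: \<delta>_def)
  have r: "r > 0" using r_pos by (simp add: r_def)
  have q: "q > 0" using \<tau> \<delta> r by (simp add: q_def)
  \<comment> \<open>From \<open>n = 2 * k\<close> on, every factor in the count of index choices is
    at least \<open>n / 2\<close>.\<close>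
  show ?thesis
  proof (intro exI[of _ "(q / 2) ^ k / 2"] exI[of _ "2 * k"] conjI allI impI)
    show "(q / 2) ^ k / 2 > 0" using q by simp
    fix n :: nat and K :: "(real ^ 'd) set"
    assume n: "2 * k \<le> n" and K: "convex_body K \<and> emeasure lborel K = 1"
    then have K1: "convex_body K" and K2: "emeasure lborel K = 1" by auto
    have KB: "K \<in> sets borel" using K1 by (simp add: convex_body_def borel_compact)
    have "extent > 0" using extent_ge_1 by simp
    then obtain v F D where F: "linear F" "bij F" "volume_scaling (\<lambda>x. v + F x) D"
      "(\<lambda>x. v + F x) ` cbox (\<chi> i. - extent) (\<chi> i. extent) \<subseteq> K"
      "D \<ge> (1 / (4 * real CARD('d) * extent)) ^ CARD('d)"
      by (rule inscribed_parallelotope[OF K1 K2])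
    have "q \<le> D * (\<tau> * (2 * r) ^ CARD('d))"
      unfolding q_def \<delta>_def r_def using F(5) \<tau> r by (intro mult_right_mono) (auto simp: r_def)
    moreover have "0 < n" using n k by simp
    ultimately show "ennreal ((q / 2) ^ k / 2 * real n ^ CARD('d)) \<le> expected_holes K k n"
      using q unfolding r_def
      by (intro expected_holes_ge[OF _ \<tau>_def refl F(1-4) KB K2 _ _ n]) auto
  qed
qed

end
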